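(* Let $m\ge 2$ and $n\ge 1$ be integers. Then, as formal power series in $q,z_1,\ldots,z_{m-1}$, $$\sum_{\mu\in\mathcal{L}_{m\searrow}^n} z_1^{s_1(\mu)}\cdots z_{m-1}^{s_{m-1}(\mu)}q^{|\mu|}=\sum_{\lambda\in\mathcal{O}_{m\searrow}^n} z_1^{\ell_1(\lambda)}\cdots z_{m-1}^{\ell_{m-1}(\lambda)}q^{|\lambda|},$$ where $\mathcal{L}_{m\searrow}^n$ and $\mathcal{O}_{m\searrow}^n$ are the sets of partitions defined in the context.
   Context: A partition $\lambda=(\lambda_1,\lambda_2,\ldots)$ is a nonincreasing sequence of nonnegative integers with finitely many nonzero terms (zeros are appended as needed); $|\lambda|=\sum_i\lambda_i$ is its weight and $l(\lambda)$ is the number of nonzero parts. For $1\le i\le m$, let $s_i(\lambda)=\lambda_i-\lambda_{i+1}+\lambda_{m+i}-\lambda_{m+i+1}+\lambda_{2m+i}-\lambda_{2m+i+1}+\cdots$. For $1\le i\le m$, let $\ell_i(\lambda)=\#\{j:\lambda_j>0,\ \lambda_j\equiv i \pmod m\}$. $\mathcal{O}_{m\searrow}^n$ is the set of partitions $\lambda$ such that no nonzero part is divisible by $m$, the least nonnegative residues modulo $m$ of the nonzero parts $\lambda_1,\lambda_2,\ldots$ (taken in order) form a nonincreasing sequence, and $\lambda_1<nm$. $\mathcal{D}_m$ is the set of partitions in which each nonzero part appears at most $m-1$ times. For $\lambda\in\mathcal{D}_m$ and each $i$ with $0\le i\le\lfloor (l(\lambda)-1)/m\rfloor$, the block $\lambda_{im+1}\ge\cdots\ge\lambda_{im+m}$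 satisfies $\lambda_{im+1}>\lambda_{im+m}$; define $\mathrm{fb}_i$ as the largest $j\in\{1,\dots,m\}$ with $\lambda_{im+j}=\lambda_{im+1}$ and $\mathrm{lb}_i$ as the largest $k\in\{1,\dots,m\}$ with $\lambda_{im+k}>\lambda_{im+m}$ (so $\lambda_{im+1}=\cdots=\lambda_{im+j}>\lambda_{im+j+1}\ge\cdots\ge\lambda_{im+k}>\lambda_{im+k+1}=\cdots=\lambda_{im+m}$). $\mathcal{L}_{m\searrow}^n$ is the set of $\lambda\in\mathcal{D}_m$ with $l(\lambda)\le\lfloor (n+1)/2\rfloor(m-2)+n$ such that: (1) for all $0\le i<\lfloor (l(\lambda)-1)/m\rfloor$, $\mathrm{lb}_i\le \mathrm{fb}_{i+1}$; and (2) if $n=2k$, then $\frac{\lambda_1}{n}\ge\frac{\lambda_m}{n-1}\ge\frac{\lambda_{m+1}}{n-2}\ge\frac{\lambda_{2m}}{n-3}\ge\cdots\ge\frac{\lambda_{(k-1)m+1}}{2}\ge\frac{\lambda_{km}}{1}$, and if $n=2k+1$, then $\frac{\lambda_1}{n}\ge\frac{\lambda_m}{n-1}\ge\frac{\lambda_{m+1}}{n-2}\ge\frac{\lambda_{2m}}{n-3}\ge\cdots\ge\frac{\lambda_{km+1}}{1}\ge\frac{\lambda_{km+m}}{0}$, with the convention that a fraction $p/0$ forces $p=0$. *)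

theory Defs
  imports
    "HOL-Analysis.Infinite_Sum"
    "HOL-Library.Poly_Mapping"
    "HOL-Computational_Algebra.Formal_Power_Series"
begin

text \<open>A partition is a function on positive indices, so that \<^term>\<open>f i\<close> is the \<open>i\<close>-th part.
  Index 0 carries no part; its value is fixed to 0 so that each partition is represented exactly
  once.\<close>

definition is_partition :: "(nat \<Rightarrow> nat) \<Rightarrow> bool" where
  "is_partition f \<longleftrightarrow> f 0 = 0 \<and> antimono_on {1..} f \<and> finite {i. f i \<noteq> 0}"

definition weight :: "(nat \<Rightarrow> nat) \<Rightarrow> nat" where
  "weight f = (\<Sum>i | f i \<noteq> 0. f i)"

definition num_parts :: "(nat \<Rightarrow> nat) \<Rightarrow> nat" where
  "num_parts f = card {i. f i \<noteq> 0}"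

text \<open>For \<open>1 \<le> i\<close> the differences below are nonnegative on a partition, so subtraction on
  naturals is not truncated, and only finitely many of them are nonzero.\<close>

definition alt_sum :: "nat \<Rightarrow> nat \<Rightarrow> (nat \<Rightarrow> nat) \<Rightarrow> nat" where
  "alt_sum m i f = Sum_any (\<lambda>j. f (j * m + i) - f (j * m + i + 1))"

definition residue_count :: "nat \<Rightarrow> nat \<Rightarrow> (nat \<Rightarrow> nat) \<Rightarrow> nat" where
  "residue_count m i f = card {j. f j > 0 \<and> f j mod m = i mod m}"

definition O_desc :: "nat \<Rightarrow> nat \<Rightarrow> (nat \<Rightarrow> nat) set" where
  "O_desc m n = {f. is_partition f
      \<and> (\<forall>j. f j > 0 \<longrightarrow> \<not> m dvd f j)
      \<and> antimono_on {j. f j > 0} (\<lambda>j. f j mod m)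
      \<and> f 1 < n * m}"

definition D_mult :: "nat \<Rightarrow> (nat \<Rightarrow> nat) set" where
  "D_mult m = {f. is_partition f \<and> (\<forall>p>0. card {j. f j = p} \<le> m - 1)}"

text \<open>The maxima below are over nonempty sets for \<open>f \<in> D_mult m\<close>, \<open>m \<ge> 2\<close> and blocks
  containing a nonzero part, the only case in which they are used.\<close>

definition fb :: "nat \<Rightarrow> (nat \<Rightarrow> nat) \<Rightarrow> nat \<Rightarrow> nat" where
  "fb m f i = Max {j \<in> {1..m}. f (i * m + j) = f (i * m + 1)}"

definition lb :: "nat \<Rightarrow> (nat \<Rightarrow> nat) \<Rightarrow> nat \<Rightarrow> nat" where
  "lb m f i = Max {k \<in> {1..m}. f (i * m + k) > f (i * m + m)}"

text \<open>The numerators of the chain of fractions, numbered from \<open>r = 0\<close>: first and last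
  part of each block in turn; the \<open>r\<close>-th denominator is \<open>n - r\<close>.\<close>

definition block_end :: "nat \<Rightarrow> (nat \<Rightarrow> nat) \<Rightarrow> nat \<Rightarrow> nat" where
  "block_end m f r =
     (if even r then f ((r div 2) * m + 1) else f ((r div 2 + 1) * m))"

text \<open>For even \<open>n\<close> the chain ends with denominator 1. For odd \<open>n\<close> it has one further member
  \<open>p/0\<close>, which by convention means \<open>p = 0\<close>; since HOL division by zero yields 0, this member is
  the separate second conjunct.\<close>

definition fraction_chain :: "nat \<Rightarrow> nat \<Rightarrow> (nat \<Rightarrow> nat) \<Rightarrow> bool" where
  "fraction_chain m n f \<longleftrightarrow>
     (\<forall>r. r + 1 < n \<longrightarrow>
        (of_nat (block_end m f r) / of_nat (n - r) :: rat)
          \<ge> of_nat (block_end m f (r + 1)) / of_nat (n - (r + 1)))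
     \<and> (odd n \<longrightarrow> block_end m f n = 0)"

text \<open>For the empty partition \<open>num_parts f - 1\<close> truncates to 0, and the condition on blocks is
  vacuous as intended.\<close>

definition L_desc :: "nat \<Rightarrow> nat \<Rightarrow> (nat \<Rightarrow> nat) set" where
  "L_desc m n = {f \<in> D_mult m.
      num_parts f \<le> ((n + 1) div 2) * (m - 2) + n
      \<and> (\<forall>i < (num_parts f - 1) div m. lb m f i \<le> fb m f (i + 1))
      \<and> fraction_chain m n f}"

text \<open>Power series in \<open>q\<close> whose coefficients are integer polynomials in \<open>z\<^sub>i\<close>, \<open>i \<in> \<nat>\<close>. As
  there are finitely many partitions of each weight, the generating functions converge in the
  \<open>q\<close>-adic topology of the library.\<close>

type_synonym qz_series = "((nat \<Rightarrow>\<^sub>0 nat) \<Rightarrow>\<^sub>0 int) fps"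

definition q_var :: qz_series where
  "q_var = fps_X"

definition z_var :: "nat \<Rightarrow> qz_series" where
  "z_var i = fps_const (Poly_Mapping.single (Poly_Mapping.single i 1) 1)"

definition L_term :: "nat \<Rightarrow> (nat \<Rightarrow> nat) \<Rightarrow> qz_series" where
  "L_term m f = (\<Prod>i = 1..m - 1. z_var i ^ alt_sum m i f) * q_var ^ weight f"

definition O_term :: "nat \<Rightarrow> (nat \<Rightarrow> nat) \<Rightarrow> qz_series" where
  "O_term m f = (\<Prod>i = 1..m - 1. z_var i ^ residue_count m i f) * q_var ^ weight f"

end

theory Submission
  imports Defs
begin

text \<open>Cut a partition in \<open>L_desc m n\<close> into blocks of \<open>m\<close> parts. The first and last parts of the blocks
  form a lecture hall sequence \<open>e\<^sub>0, e\<^sub>1, \<dots>\<close> of length \<open>n\<close>, and the condition on \<open>lb\<close> and \<open>fb\<close> says that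
  the descents inside the blocks have nondecreasing positions. The partition is therefore
  determined by \<open>e\<close> and the numbers \<open>c\<^sub>i = s\<^sub>i\<close>, subject only to \<open>\<Sum>c\<^sub>i = e\<^sub>0 - e\<^sub>1 + e\<^sub>2 - \<dots>\<close>, and its weight
  is \<open>m (e\<^sub>1 + e\<^sub>3 + \<dots>) + \<Sum>i c\<^sub>i\<close>. Similarly, writing the parts of a partition in \<open>O_desc m n\<close> as \<open>m b + r\<close>
  gives two nonincreasing words of equal length in the letters \<open>b < n\<close> and \<open>0 < r < m\<close>; the partition
  is determined by their letter counts \<open>a\<^sub>k\<close>, \<open>c\<^sub>i\<close> and has weight \<open>m \<Sum>k a\<^sub>k + \<Sum>i c\<^sub>i\<close>.

  It remains to match lecture hall sequences of length \<open>n\<close> with multiplicities \<open>a\<close> on \<open>{0..<n}\<close> so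
  that the alternating sum becomes \<open>\<Sum>a\<^sub>k\<close> and the sum of the odd-indexed entries becomes \<open>\<Sum>k a\<^sub>k\<close>.
  This is the refined lecture hall theorem of Bousquet-Melou and Eriksson, by induction on \<open>n\<close>:
  drop the first entry, keep its excess as \<open>a\<^sub>0\<close>, and reflect each odd-indexed entry of the rest in
  the interval left to it by its neighbours.\<close>

section \<open>The refined lecture hall theorem\<close>

text \<open>The chain \<open>e 0 / n \<ge> e 1 / (n - 1) \<ge> ...\<close> with denominators
  cleared. For \<open>r \<ge> n\<close> both differences are 0 and the inequality is trivial, so the
  zero tail is a clause of its own.\<close>

definition lecture_hall :: "nat \<Rightarrow> (nat \<Rightarrow> nat) set" where
  "lecture_hall n = {e. (\<forall>r. e (Suc r) * (n - r) \<le> e r * (n - Suc r)) \<and> (\<forall>r\<ge>n. e r = 0)}"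

text \<open>The range \<open>i < n\<close> reaches past the end of a lecture hall sequence of length
  \<open>n\<close>; the extra terms are 0, and the parity of \<open>n\<close> need not be
  distinguished.\<close>

definition even_sum :: "nat \<Rightarrow> (nat \<Rightarrow> nat) \<Rightarrow> nat" where
  "even_sum n e = (\<Sum>i<n. e (2 * i))"

definition odd_sum :: "nat \<Rightarrow> (nat \<Rightarrow> nat) \<Rightarrow> nat" where
  "odd_sum n e = (\<Sum>i<n. e (2 * i + 1))"

definition multiplicities :: "nat \<Rightarrow> (nat \<Rightarrow> nat) set" where
  "multiplicities n = {a. \<forall>k\<ge>n. a k = 0}"

text \<open>The ceiling of \<open>a / k\<close>. For \<open>k = 0\<close> it is 0, the right value
  past the end of a sequence, where \<open>a = 0\<close>.\<close>

definition ceil_div :: "nat \<Rightarrow> nat \<Rightarrow> nat" where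
  "ceil_div a k = (a + k - 1) div k"

lemma ceil_div_le_iff: "k > 0 \<Longrightarrow> ceil_div a k \<le> y \<longleftrightarrow> a \<le> y * k"
  unfolding ceil_div_def
  by (subst less_Suc_eq_le[symmetric], subst div_less_iff_less_mult) auto

lemma ceil_div_simps [simp]: "ceil_div 0 k = 0" "ceil_div a (Suc 0) = a" "ceil_div a 0 = 0"
  by (cases "k = 0"; simp add: ceil_div_def)+

text \<open>Writing \<open>x = b + d\<close> turns the left side into \<open>b \<le> d * k\<close>;
  for \<open>x < b\<close> both sides fail. So \<open>b + ceil_div b k\<close> is the least entry
  that can precede \<open>b\<close> in a lecture hall sequence.\<close>

lemma lower_bound_iff:
  fixes b k x :: nat
  assumes "k > 0"
  shows "b * Suc k \<le> x * k \<longleftrightarrow> b + ceil_div b k \<le> x"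
proof (cases "b \<le> x")
  case True
  then obtain d where "x = b + d" using le_Suc_ex by blast
  then show ?thesis using ceil_div_le_iff[OF assms, of b d] by (simp add: algebra_simps)
next
  case False
  then have "x * k \<le> b * k" "b > 0" by auto
  then have "x * k < b * Suc k" unfolding mult_Suc_right by linarith
  then show ?thesis using False by linarith
qed

lemma ceil_div_le: "ceil_div a k \<le> a"
  by (cases "k = 0") (auto simp: ceil_div_le_iff)

lemma upper_bound_iff:
  fixes a k y :: nat
  shows "y * Suc k \<le> a * k \<longleftrightarrow> y \<le> a - ceil_div a (Suc k)"
proof (cases "y \<le> a")
  case True
  then obtain d where d: "a = y + d" using le_Suc_ex by blast
  have "y \<le> a - ceil_div a (Suc k) \<longleftrightarrow> ceil_div a (Suc k) \<le> d"
    using d ceil_div_le[of a "Suc k"] by linarith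
  then show ?thesis using ceil_div_le_iff[of "Suc k" a d] d by (simp add: algebra_simps)
next
  case False
  then have "a * k \<le> y * k" "y > 0" by auto
  then have "a * k < y * Suc k" unfolding mult_Suc_right by linarith
  then show ?thesis using False by linarith
qed

lemma lecture_hall_step_lower:
  assumes "\<forall>r\<ge>n. e r = 0"
  shows "e (Suc r) * (n - r) \<le> e r * (n - Suc r) \<longleftrightarrow>
    e (Suc r) + ceil_div (e (Suc r)) (n - Suc r) \<le> e r"
proof (cases "Suc r < n")
  case True
  then have "n - r = Suc (n - Suc r)" "n - Suc r > 0" by auto
  then show ?thesis using lower_bound_iff[of "n - Suc r"] by metis
next
  case False
  then show ?thesis using assms by simp
qed

lemma lecture_hall_step_upper:
  assumes "\<forall>r\<ge>n. e r = 0"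
  shows "e (Suc r) * (n - r) \<le> e r * (n - Suc r) \<longleftrightarrow>
    e (Suc r) \<le> e r - ceil_div (e r) (n - r)"
proof (cases "r < n")
  case True
  then have "n - r = Suc (n - Suc r)" by auto
  then show ?thesis using upper_bound_iff[of "e (Suc r)"] by metis
next
  case False
  then show ?thesis using assms by simp
qed

text \<open>For fixed even entries, each odd entry of a lecture hall sequence ranges independently over
  an integer interval; this reverses those intervals.\<close>

definition reflect_odd :: "nat \<Rightarrow> (nat \<Rightarrow> nat) \<Rightarrow> nat \<Rightarrow> nat" where
  "reflect_odd n e r = (if even r then e r else
     (e (r - 1) - ceil_div (e (r - 1)) (n - (r - 1))) +
     (e (Suc r) + ceil_div (e (Suc r)) (n - Suc r)) - e r)"

lemma lecture_hall_odd_bounds: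
  assumes "e \<in> lecture_hall n" "odd r"
  shows "e (Suc r) + ceil_div (e (Suc r)) (n - Suc r) \<le> e r"
    "e r \<le> e (r - 1) - ceil_div (e (r - 1)) (n - (r - 1))"
proof -
  have z: "\<forall>r\<ge>n. e r = 0" and st: "\<And>r. e (Suc r) * (n - r) \<le> e r * (n - Suc r)"
    using assms(1) by (auto simp: lecture_hall_def)
  obtain r' where r: "r = Suc r'" using assms(2) by (cases r) auto
  show "e (Suc r) + ceil_div (e (Suc r)) (n - Suc r) \<le> e r"
    using lecture_hall_step_lower[OF z] st by blast
  show "e r \<le> e (r - 1) - ceil_div (e (r - 1)) (n - (r - 1))"
    using lecture_hall_step_upper[OF z, of r'] st r by simp
qed

lemma reflect_odd_mem:
  assumes e: "e \<in> lecture_hall n"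
  shows "reflect_odd n e \<in> lecture_hall n"
proof -
  let ?f = "reflect_odd n e"
  have z: "\<forall>r\<ge>n. e r = 0" using e by (auto simp: lecture_hall_def)
  have zf: "\<forall>r\<ge>n. ?f r = 0"
  proof (intro allI impI)
    fix r assume "r \<ge> n"
    then consider "even r" | "odd r" "r = n" | "odd r" "r - 1 \<ge> n" by linarith
    then show "?f r = 0"
    proof cases
      case 2
      \<comment> \<open>An odd \<open>r = n\<close> is the one position past the end whose left
        neighbour can be nonzero; its upper bound is still 0, because
        \<open>ceil_div a 1 = a\<close>.\<close>
      then have "n - (n - 1) = Suc 0" by (cases n) auto
      with 2 z show ?thesis by (simp add: reflect_odd_def)
    qed (use z \<open>r \<ge> n\<close> in \<open>auto simp: reflect_odd_def\<close>)
  qed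
  have ev: "?f r = e r" if "even r" for r using that by (simp add: reflect_odd_def)
  have "?f (Suc r) * (n - r) \<le> ?f r * (n - Suc r)" for r
  proof (cases "even r")
    case True
    then have "?f (Suc r) \<le> e r - ceil_div (e r) (n - r)"
      using lecture_hall_odd_bounds[OF e, of "Suc r"] by (simp add: reflect_odd_def)
    then show ?thesis using lecture_hall_step_upper[OF zf, of r] ev[OF True] by metis
  next
    case False
    then have "e (Suc r) + ceil_div (e (Suc r)) (n - Suc r) \<le> ?f r"
      using lecture_hall_odd_bounds[OF e, of r] by (simp add: reflect_odd_def, linarith)
    then show ?thesis unfolding lecture_hall_step_lower[OF zf] using ev[of "Suc r"] False by simp
  qed
  with zf show ?thesis by (simp add: lecture_hall_def)
qed

lemma reflect_odd_involution:
  assumes e: "e \<in> lecture_hall n"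
  shows "reflect_odd n (reflect_odd n e) = e"
proof
  fix r
  show "reflect_odd n (reflect_odd n e) r = e r"
    using lecture_hall_odd_bounds[OF e, of r] by (auto simp: reflect_odd_def)
qed

text \<open>An odd entry and its reflection add up to the two ends of its interval. Over all odd
  positions the ceiling of each even entry other than \<open>e 0\<close> occurs once with either
  sign and cancels, and the entry itself occurs twice.\<close>

lemma reflect_odd_sum:
  assumes e: "e \<in> lecture_hall n"
  shows "odd_sum n e + odd_sum n (reflect_odd n e) + e 0 + ceil_div (e 0) n = 2 * even_sum n e"
proof -
  have "odd_sum N e + odd_sum N (reflect_odd n e) + e 0 + ceil_div (e 0) n =
      2 * even_sum N e + e (2 * N) + ceil_div (e (2 * N)) (n - 2 * N)" for N
  proof (induction N)
    case (Suc N)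
    have "e (2 * N + 1) + reflect_odd n e (2 * N + 1) =
        (e (2 * N) - ceil_div (e (2 * N)) (n - 2 * N)) +
        (e (2 * N + 2) + ceil_div (e (2 * N + 2)) (n - (2 * N + 2)))"
      using lecture_hall_odd_bounds[OF e, of "2 * N + 1"] by (simp add: reflect_odd_def)
    then show ?case using Suc ceil_div_le[of "e (2 * N)" "n - 2 * N"]
      by (simp add: odd_sum_def even_sum_def)
  qed (simp add: odd_sum_def even_sum_def)
  from this[of n] show ?thesis using e by (simp add: lecture_hall_def)
qed

lemma even_sum_reflect_odd: "even_sum n (reflect_odd m e) = even_sum n e"
  by (simp add: even_sum_def reflect_odd_def)

text \<open>Denominators are counted from the right end, so removing the first entry leaves the
  conditions on the others as they were.\<close>

lemma lecture_hall_Suc_iff: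
  "e \<in> lecture_hall (Suc n) \<longleftrightarrow>
     e \<circ> Suc \<in> lecture_hall n \<and> e 1 + ceil_div (e 1) n \<le> e 0"
proof (cases "\<forall>r\<ge>Suc n. e r = 0")
  case True
  have "(\<forall>r. e (Suc r) * (Suc n - r) \<le> e r * (Suc n - Suc r)) \<longleftrightarrow>
     e 1 * Suc n \<le> e 0 * n \<and> (\<forall>r. e (Suc (Suc r)) * (n - r) \<le> e (Suc r) * (n - Suc r))"
    by (metis (no_types, lifting) One_nat_def diff_Suc_Suc diff_zero old.nat.exhaust)
  then show ?thesis using True lecture_hall_step_lower[OF True, of 0]
    by (auto simp: lecture_hall_def)
next
  case False
  then have "\<not> (\<forall>r\<ge>n. (e \<circ> Suc) r = 0)" by (metis Suc_le_D Suc_le_mono comp_apply)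
  with False show ?thesis by (auto simp: lecture_hall_def)
qed

text \<open>The first entry of a lecture hall sequence is recorded by its excess over the least value
  that the second entry allows.\<close>

lemma bij_betw_lecture_hall_Suc:
  "bij_betw (\<lambda>e. (e 0 - (e 1 + ceil_div (e 1) n), reflect_odd n (e \<circ> Suc)))
     (lecture_hall (Suc n)) (UNIV \<times> lecture_hall n)"
proof (rule bij_betw_byWitness[where f' =
      "\<lambda>(s, u). case_nat (s + (u 0 + ceil_div (u 0) n)) (reflect_odd n u)"])
  have 0: "reflect_odd n u 0 = u 0" for u by (simp add: reflect_odd_def)
  have cs: "case_nat x u \<circ> Suc = u" for x :: nat and u by auto
  show "\<forall>e\<in>lecture_hall (Suc n). (case (e 0 - (e 1 + ceil_div (e 1) n), reflect_odd n (e \<circ> Suc)) of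
      (s, u) \<Rightarrow> case_nat (s + (u 0 + ceil_div (u 0) n)) (reflect_odd n u)) = e"
    by (auto simp: lecture_hall_Suc_iff reflect_odd_involution 0 fun_eq_iff split: nat.split)
  show "\<forall>x\<in>UNIV \<times> lecture_hall n. (\<lambda>e. (e 0 - (e 1 + ceil_div (e 1) n), reflect_odd n (e \<circ> Suc)))
      (case x of (s, u) \<Rightarrow> case_nat (s + (u 0 + ceil_div (u 0) n)) (reflect_odd n u)) = x"
    by (auto simp: reflect_odd_involution 0 cs)
  show "(\<lambda>e. (e 0 - (e 1 + ceil_div (e 1) n), reflect_odd n (e \<circ> Suc))) ` lecture_hall (Suc n)
      \<subseteq> UNIV \<times> lecture_hall n"
    by (auto simp: lecture_hall_Suc_iff reflect_odd_mem)
  show "(\<lambda>(s, u). case_nat (s + (u 0 + ceil_div (u 0) n)) (reflect_odd n u)) ` (UNIV \<times> lecture_hall n)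
      \<subseteq> lecture_hall (Suc n)"
    by (auto simp: lecture_hall_Suc_iff reflect_odd_mem 0 cs)
qed

text \<open>Adding the two identities gives \<open>even_sum n e + odd_sum n e = (\<Sum>k<n. (2 * k +
  1) * g e k)\<close>, so \<open>g e k\<close> is the multiplicity of the odd part
  \<open>2 * k + 1\<close> in the usual form of the lecture hall theorem.\<close>

lemma lecture_hall_bijection:
  "\<exists>g. bij_betw g (lecture_hall n) (multiplicities n) \<and>
     (\<forall>e\<in>lecture_hall n. odd_sum n e = (\<Sum>k<n. k * g e k) \<and>
        even_sum n e = (\<Sum>k<n. g e k) + (\<Sum>k<n. k * g e k))"
proof (induction n)
  case 0
  have "lecture_hall 0 = {\<lambda>_. 0}" "multiplicities 0 = {\<lambda>_. 0}"
    by (auto simp: lecture_hall_def multiplicities_def)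
  then show ?case by (intro exI[of _ id]) (auto simp: odd_sum_def even_sum_def)
next
  case (Suc n)
  then obtain g where bij: "bij_betw g (lecture_hall n) (multiplicities n)"
    and g: "\<And>e. e \<in> lecture_hall n \<Longrightarrow> odd_sum n e = (\<Sum>k<n. k * g e k)"
      "\<And>e. e \<in> lecture_hall n \<Longrightarrow> even_sum n e = (\<Sum>k<n. g e k) + (\<Sum>k<n. k * g e k)"
    by blast
  define h1 where "h1 = (\<lambda>e :: nat \<Rightarrow> nat. (e 0 - (e 1 + ceil_div (e 1) n), reflect_odd n (e \<circ> Suc)))"
  define h where "h = (\<lambda>(s, a). case_nat s a) \<circ> (map_prod id g \<circ> h1)"
  have "bij_betw (\<lambda>(s, a). case_nat s a) (UNIV \<times> multiplicities n) (multiplicities (Suc n))"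
    by (rule bij_betw_byWitness[where f' = "\<lambda>a. (a 0, a \<circ> Suc)"])
      (auto simp: multiplicities_def fun_eq_iff split: nat.split)
  moreover have "bij_betw (map_prod id g) (UNIV \<times> lecture_hall n) (UNIV \<times> multiplicities n)"
    by (intro bij_betw_map_prod bij_betw_id bij)
  moreover have "bij_betw h1 (lecture_hall (Suc n)) (UNIV \<times> lecture_hall n)"
    unfolding h1_def by (rule bij_betw_lecture_hall_Suc)
  ultimately have "bij_betw h (lecture_hall (Suc n)) (multiplicities (Suc n))"
    unfolding h_def by (blast intro: bij_betw_trans)
  moreover have "odd_sum (Suc n) e = (\<Sum>k<Suc n. k * h e k) \<and>
      even_sum (Suc n) e = (\<Sum>k<Suc n. h e k) + (\<Sum>k<Suc n. k * h e k)"
    if e: "e \<in> lecture_hall (Suc n)" for e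
  proof -
    define u where "u = e \<circ> Suc"
    define v where "v = reflect_odd n u"
    have u: "u \<in> lecture_hall n" and lb: "e 1 + ceil_div (e 1) n \<le> e 0"
      using e by (auto simp: lecture_hall_Suc_iff u_def)
    have v: "v \<in> lecture_hall n" unfolding v_def by (rule reflect_odd_mem[OF u])
    have u0: "\<And>r. r \<ge> n \<Longrightarrow> u r = 0" using u by (auto simp: lecture_hall_def)
    have h0: "h e 0 = e 0 - (e 1 + ceil_div (e 1) n)" and hS: "\<And>k. h e (Suc k) = g v k"
      by (auto simp: h_def h1_def v_def u_def)
    have o: "odd_sum (Suc n) e = even_sum n u"
      using u0[of "2 * n"] by (simp add: odd_sum_def even_sum_def u_def)
    have ev: "even_sum (Suc n) e = e 0 + odd_sum n u"
      by (simp add: even_sum_def odd_sum_def u_def sum.lessThan_Suc_shift del: sum.lessThan_Suc)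
    \<comment> \<open>The excess enters at index 0 and has no share in the weighted sum; every other
      index moves up by one, which adds \<open>\<Sum>k<n. g v k\<close> to it.\<close>
    have w: "(\<Sum>k<Suc n. h e k) = h e 0 + (\<Sum>k<n. g v k)"
      "(\<Sum>k<Suc n. k * h e k) = (\<Sum>k<n. g v k) + (\<Sum>k<n. k * g v k)"
      by (simp_all add: sum.lessThan_Suc_shift hS sum.distrib del: sum.lessThan_Suc)
    have "even_sum n v = even_sum n u" by (simp add: v_def even_sum_reflect_odd)
    moreover have "odd_sum n u + odd_sum n v + e 1 + ceil_div (e 1) n = 2 * even_sum n u"
      using reflect_odd_sum[OF u] by (simp add: v_def u_def)
    ultimately show ?thesis using g[OF v] o ev w h0 lb by linarith
  qed
  ultimately show ?case by blast
qed

section \<open>Partitions with falling residues\<close>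

lemma initial_segment:
  assumes "finite K" "0 \<notin> K" "\<And>j k. k \<in> K \<Longrightarrow> 1 \<le> j \<Longrightarrow> j \<le> k \<Longrightarrow> j \<in> K"
  shows "K = {1..card K :: nat}"
proof (cases "K = {}")
  case False
  then have M: "Max K \<in> K" using assms(1) by simp
  have "K = {1..Max K}"
  proof
    show "K \<subseteq> {1..Max K}" using assms(1,2) by (auto simp: Suc_le_eq intro: gr0I)
    show "{1..Max K} \<subseteq> K" using assms(3)[OF M] by auto
  qed
  then show ?thesis by (metis card_atLeastAtMost diff_Suc_1)
qed simp

lemma partition_support:
  assumes "is_partition f"
  shows "{j. f j \<noteq> 0} = {1..num_parts f}"
  unfolding num_parts_def
proof (rule initial_segment)
  show "finite {j. f j \<noteq> 0}" "0 \<notin> {j. f j \<noteq> 0}" using assms by (auto simp: is_partition_def)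
  fix j k assume "k \<in> {j. f j \<noteq> 0}" "1 \<le> j" "j \<le> k"
  moreover have "f k \<le> f j"
    using assms \<open>1 \<le> j\<close> \<open>j \<le> k\<close> by (auto simp: is_partition_def monotone_on_def)
  ultimately show "j \<in> {j. f j \<noteq> 0}" by simp
qed

lemma partition_pos_iff:
  assumes "is_partition f"
  shows "f j > 0 \<longleftrightarrow> 1 \<le> j \<and> j \<le> num_parts f"
  using partition_support[OF assms] by (auto simp: set_eq_iff)

lemma partition_antimono:
  "is_partition f \<Longrightarrow> 1 \<le> i \<Longrightarrow> i \<le> j \<Longrightarrow> f j \<le> f i"
  by (auto simp: is_partition_def monotone_on_def)

lemma weight_partition: "is_partition f \<Longrightarrow> weight f = (\<Sum>x\<in>{1..num_parts f}. f x)"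
  unfolding weight_def partition_support[symmetric] ..

text \<open>The \<open>x\<close>-th letter, counted from 1, of the nonincreasing word in which each letter
  \<open>k < n\<close> occurs \<open>a k\<close> times.\<close>

definition falling_word :: "nat \<Rightarrow> (nat \<Rightarrow> nat) \<Rightarrow> nat \<Rightarrow> nat" where
  "falling_word n a x = card {k \<in> {1..<n}. x \<le> sum a {k..<n}}"

section \<open>Letter counts of nonincreasing words\<close>

lemma sum_tail_antimono: "j \<le> k \<Longrightarrow> sum a {k..<n} \<le> sum a {j..<n}" for a :: "nat \<Rightarrow> nat"
  by (rule sum_mono2) auto

text \<open>Tail sums fall as \<open>k\<close> grows, so the letters counted in
  \<open>falling_word\<close> form an initial segment, and its size is the largest of them.\<close>

lemma falling_word_ge_iff:
  assumes "1 \<le> k"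
  shows "k \<le> falling_word n a x \<longleftrightarrow> k < n \<and> x \<le> sum a {k..<n}"
proof -
  let ?K = "{k \<in> {1..<n}. x \<le> sum a {k..<n}}"
  have "?K = {1..card ?K}"
    by (rule initial_segment) (auto dest: sum_tail_antimono[of _ _ a n])
  then have "k \<in> ?K \<longleftrightarrow> k \<in> {1..falling_word n a x}" unfolding falling_word_def by metis
  then show ?thesis using assms by auto
qed

lemma falling_word_less: "0 < n \<Longrightarrow> falling_word n a x < n"
  using falling_word_ge_iff[of n n a x] by linarith

lemma falling_word_antimono: "x \<le> y \<Longrightarrow> falling_word n a y \<le> falling_word n a x"
  unfolding falling_word_def by (rule card_mono) auto

lemma falling_word_eq_0:
  assumes "x > sum a {..<n}"
  shows "falling_word n a x = 0"
  using falling_word_ge_iff[of 1 n a x] sum_tail_antimono[of 0 1 a n] assms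
  by (auto simp: atLeast0LessThan)

lemma card_falling_word:
  assumes "k < n"
  shows "card {x \<in> {1..sum a {..<n}}. falling_word n a x = k} = a k"
proof -
  have seg: "{x \<in> {1..sum a {..<n}}. j \<le> falling_word n a x} = {1..sum a {j..<n}}" if "j \<le> n" for j
  proof (cases "j = 0")
    case False
    have "sum a {j..<n} \<le> sum a {..<n}"
      using sum_tail_antimono[of 0 j a n] by (simp add: atLeast0LessThan)
    then show ?thesis using that False by (cases "j = n") (auto simp: falling_word_ge_iff)
  qed (auto simp: atLeast0LessThan)
  have "{x \<in> {1..sum a {..<n}}. falling_word n a x = k} =
      {x \<in> {1..sum a {..<n}}. k \<le> falling_word n a x} - {x \<in> {1..sum a {..<n}}. Suc k \<le> falling_word n a x}"
    by auto
  also have "\<dots> = {1..sum a {k..<n}} - {1..sum a {Suc k..<n}}"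
    using assms by (simp only: seg less_imp_le Suc_leI)
  also have "card \<dots> = sum a {k..<n} - sum a {Suc k..<n}"
    by (subst card_Diff_subset) (use sum_tail_antimono[of k "Suc k" a n] in auto)
  also have "\<dots> = a k" using assms by (simp add: sum.atLeast_Suc_lessThan)
  finally show ?thesis .
qed

text \<open>The tail sum of the counts from \<open>k\<close> on is the number of positions with
  letter at least \<open>k\<close>. As \<open>h\<close> is nonincreasing, these positions come
  first, so the counts determine the word.\<close>

lemma falling_word_of_counts:
  assumes anti: "\<And>x y. 1 \<le> x \<Longrightarrow> x \<le> y \<Longrightarrow> y \<le> l \<Longrightarrow> h y \<le> h x"
    and less: "\<And>x. x \<in> {1..l} \<Longrightarrow> h x < n" and x: "x \<in> {1..l}"
  shows "falling_word n (\<lambda>k. card {y \<in> {1..l}. h y = k}) x = h x"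
proof -
  have tail: "(\<Sum>k'\<in>{k..<n}. card {y \<in> {1..l}. h y = k'}) = card {y \<in> {1..l}. k \<le> h y}" for k
  proof -
    have "(\<Sum>k'\<in>{k..<n}. card {y \<in> {1..l}. h y = k'}) = card (\<Union>k'\<in>{k..<n}. {y \<in> {1..l}. h y = k'})"
      by (rule card_UN_disjoint[symmetric]) auto
    also have "(\<Union>k'\<in>{k..<n}. {y \<in> {1..l}. h y = k'}) = {y \<in> {1..l}. k \<le> h y}"
      using less by auto
    finally show ?thesis .
  qed
  have "{y \<in> {1..l}. k \<le> h y} = {1..card {y \<in> {1..l}. k \<le> h y}}" for k
    by (rule initial_segment) (auto dest: anti[rotated] intro: order_trans)
  then have "x \<le> card {y \<in> {1..l}. k \<le> h y} \<longleftrightarrow> k \<le> h x" for k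
    using x by (metis (no_types, lifting) atLeastAtMost_iff mem_Collect_eq)
  then have "falling_word n (\<lambda>k. card {y \<in> {1..l}. h y = k}) x = card {k \<in> {1..<n}. k \<le> h x}"
    unfolding falling_word_def tail by simp
  also have "{k \<in> {1..<n}. k \<le> h x} = {1..h x}" using less[OF x] by auto
  finally show ?thesis by simp
qed

lemma sum_by_counts:
  fixes h g :: "nat \<Rightarrow> nat"
  assumes "finite X" "\<And>x. x \<in> X \<Longrightarrow> h x < n"
  shows "(\<Sum>x\<in>X. g (h x)) = (\<Sum>k<n. g k * card {x \<in> X. h x = k})"
proof -
  have "(\<Sum>x\<in>X. g (h x)) = (\<Sum>k<n. \<Sum>x | x \<in> X \<and> h x = k. g (h x))"
    by (rule sum.group[symmetric]) (use assms in auto)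
  then show ?thesis by (simp add: mult.commute)
qed

text \<open>Here \<open>a\<close> counts the quotients and \<open>c\<close> the residues of the
  parts modulo \<open>m\<close>: \<open>c 0 = 0\<close> says that no part is divisible by
  \<open>m\<close>, and the equal sums that both words have one letter per part.\<close>

definition balanced_pairs :: "nat \<Rightarrow> nat \<Rightarrow> ((nat \<Rightarrow> nat) \<times> (nat \<Rightarrow> nat)) set" where
  "balanced_pairs m n =
     {(a, c). a \<in> multiplicities n \<and> c \<in> multiplicities m \<and> c 0 = 0 \<and> sum a {..<n} = sum c {..<m}}"

definition quotient_residue_counts :: "nat \<Rightarrow> (nat \<Rightarrow> nat) \<Rightarrow> (nat \<Rightarrow> nat) \<times> (nat \<Rightarrow> nat)" where
  "quotient_residue_counts m f =
     (\<lambda>k. card {j. f j > 0 \<and> f j div m = k}, \<lambda>i. card {j. f j > 0 \<and> f j mod m = i})"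

text \<open>Position 0 is a separate case, since \<open>falling_word n a 0\<close> is the greatest
  letter \<open>n - 1\<close>.\<close>

definition partition_of_counts ::
    "nat \<Rightarrow> nat \<Rightarrow> (nat \<Rightarrow> nat) \<times> (nat \<Rightarrow> nat) \<Rightarrow> nat \<Rightarrow> nat" where
  "partition_of_counts m n p x =
     (if x = 0 then 0 else m * falling_word n (fst p) x + falling_word m (snd p) x)"

section \<open>Partitions in \<open>O_desc\<close> as pairs of letter counts\<close>

context
  fixes m n :: nat
  assumes m: "m \<ge> 2" and n: "n \<ge> 1"
begin

lemma O_desc_quotient_less:
  assumes "f \<in> O_desc m n" "1 \<le> x"
  shows "f x div m < n"
proof -
  have "f x \<le> f 1" using assms partition_antimono[of f 1 x] by (simp add: O_desc_def)
  then show ?thesis using assms m by (simp add: O_desc_def less_mult_imp_div_less)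
qed

lemma O_desc_counts:
  assumes "f \<in> O_desc m n"
  shows "quotient_residue_counts m f =
    (\<lambda>k. card {j \<in> {1..num_parts f}. f j div m = k}, \<lambda>i. card {j \<in> {1..num_parts f}. f j mod m = i})"
  using partition_pos_iff[of f] assms by (auto simp: O_desc_def quotient_residue_counts_def)

lemma O_desc_counts_mem:
  assumes f: "f \<in> O_desc m n"
  shows "quotient_residue_counts m f \<in> balanced_pairs m n"
proof -
  let ?l = "num_parts f"
  have "sum (\<lambda>k. card {j \<in> {1..?l}. f j div m = k}) {..<n} = ?l"
    using sum_by_counts[of "{1..?l}" "\<lambda>j. f j div m" n "\<lambda>_. 1"] O_desc_quotient_less[OF f] by simp
  moreover have "sum (\<lambda>k. card {j \<in> {1..?l}. f j mod m = k}) {..<m} = ?l"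
    using sum_by_counts[of "{1..?l}" "\<lambda>j. f j mod m" m "\<lambda>_. 1"] m by simp
  moreover have "{j \<in> {1..?l}. f j div m = k} = {}" if "k \<ge> n" for k
    using O_desc_quotient_less[OF f] that by force
  moreover have "{j \<in> {1..?l}. f j mod m = k} = {}" if "k \<ge> m" for k
    using m that mod_less_divisor[of m "f j" for j] by (fastforce simp: not_less[symmetric])
  moreover have "{j \<in> {1..?l}. f j mod m = 0} = {}"
    using f partition_pos_iff[of f] by (auto simp: O_desc_def dvd_eq_mod_eq_0)
  ultimately show ?thesis
    unfolding O_desc_counts[OF f] by (simp add: balanced_pairs_def multiplicities_def)
qed

lemma partition_of_counts_inverse:
  assumes f: "f \<in> O_desc m n"
  shows "partition_of_counts m n (quotient_residue_counts m f) = f"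
proof
  fix x
  let ?l = "num_parts f"
  have p: "is_partition f" using f by (simp add: O_desc_def)
  consider "x = 0" | "x \<in> {1..?l}" | "x > ?l" by force
  then show "partition_of_counts m n (quotient_residue_counts m f) x = f x"
  proof cases
    case 1
    then show ?thesis using p by (simp add: partition_of_counts_def is_partition_def)
  next
    case 2
    have "f y mod m \<le> f x mod m" if "1 \<le> x" "x \<le> y" "y \<le> ?l" for x y
      using f that partition_pos_iff[OF p] by (auto simp: O_desc_def monotone_on_def)
    then have "falling_word m (\<lambda>i. card {j \<in> {1..?l}. f j mod m = i}) x = f x mod m"
      by (rule falling_word_of_counts) (use 2 m in auto)
    moreover have "falling_word n (\<lambda>i. card {j \<in> {1..?l}. f j div m = i}) x = f x div m"
      by (rule falling_word_of_counts)
        (use 2 partition_antimono[OF p] O_desc_quotient_less[OF f] in \<open>auto intro: div_le_mono\<close>)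
    ultimately show ?thesis using 2 by (simp add: partition_of_counts_def O_desc_counts[OF f])
  next
    case 3
    have "sum (\<lambda>k. card {j \<in> {1..?l}. f j div m = k}) {..<n} = ?l"
      using sum_by_counts[of "{1..?l}" "\<lambda>j. f j div m" n "\<lambda>_. 1"] O_desc_quotient_less[OF f] by simp
    moreover have "sum (\<lambda>k. card {j \<in> {1..?l}. f j mod m = k}) {..<m} = ?l"
      using sum_by_counts[of "{1..?l}" "\<lambda>j. f j mod m" m "\<lambda>_. 1"] m by simp
    moreover have "f x = 0" using 3 partition_pos_iff[OF p, of x] by auto
    ultimately show ?thesis using 3
      by (simp add: partition_of_counts_def O_desc_counts[OF f] falling_word_eq_0)
  qed
qed

lemma partition_of_counts_props:
  assumes "(a, c) \<in> balanced_pairs m n"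
  defines "f \<equiv> partition_of_counts m n (a, c)"
  shows "x \<in> {1..sum a {..<n}} \<Longrightarrow> f x div m = falling_word n a x"
    and "x \<in> {1..sum a {..<n}} \<Longrightarrow> f x mod m = falling_word m c x"
    and "x \<in> {1..sum a {..<n}} \<Longrightarrow> falling_word m c x > 0"
    and "f x > 0 \<longleftrightarrow> x \<in> {1..sum a {..<n}}"
proof -
  have S: "sum c {..<m} = sum a {..<n}" and c0: "c 0 = 0" using assms(1) by (auto simp: balanced_pairs_def)
  have "falling_word m c x < m" by (rule falling_word_less) (use m in simp)
  then show "x \<in> {1..sum a {..<n}} \<Longrightarrow> f x div m = falling_word n a x"
    "x \<in> {1..sum a {..<n}} \<Longrightarrow> f x mod m = falling_word m c x"
    by (auto simp: f_def partition_of_counts_def)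
  \<comment> \<open>As \<open>c 0 = 0\<close>, the tail sum from 1 is already the full length, so
    every letter up to there is at least 1.\<close>
  have "sum c {1..<m} = sum a {..<n}"
    using S c0 m sum.atLeast_Suc_lessThan[of 0 m c] by (simp add: atLeast0LessThan)
  then show pos: "x \<in> {1..sum a {..<n}} \<Longrightarrow> falling_word m c x > 0"
    using falling_word_ge_iff[of 1 m c x] m by simp
  show "f x > 0 \<longleftrightarrow> x \<in> {1..sum a {..<n}}"
  proof
    assume "x \<in> {1..sum a {..<n}}"
    then show "f x > 0" using pos by (auto simp: f_def partition_of_counts_def)
  next
    assume "f x > 0"
    moreover have "f x = 0" if "x > sum a {..<n}"
      using that S by (simp add: f_def partition_of_counts_def falling_word_eq_0)
    moreover have "f 0 = 0" by (simp add: f_def partition_of_counts_def)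
    ultimately show "x \<in> {1..sum a {..<n}}" by (cases "x = 0") (auto simp: not_less[symmetric])
  qed
qed

lemma counts_partition_of_counts:
  assumes "(a, c) \<in> balanced_pairs m n"
  shows "quotient_residue_counts m (partition_of_counts m n (a, c)) = (a, c)"
proof -
  note props = partition_of_counts_props[OF assms]
  let ?f = "partition_of_counts m n (a, c)"
  have S: "sum c {..<m} = sum a {..<n}" using assms(1) by (auto simp: balanced_pairs_def)
  have "card {j. ?f j > 0 \<and> ?f j div m = k} = a k" for k
  proof -
    have *: "{j. ?f j > 0 \<and> ?f j div m = k} = {x \<in> {1..sum a {..<n}}. falling_word n a x = k}"
      by (intro Collect_cong) (metis props(1,4))
    show ?thesis
    proof (cases "k < n")
      case False
      have "falling_word n a x \<noteq> k" for x
        using falling_word_less[of n a x] n False by linarith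
      then have "{x \<in> {1..sum a {..<n}}. falling_word n a x = k} = {}" by simp
      then show ?thesis using * False assms by (simp add: balanced_pairs_def multiplicities_def)
    qed (simp only: * card_falling_word)
  qed
  moreover have "card {j. ?f j > 0 \<and> ?f j mod m = k} = c k" for k
  proof -
    have *: "{j. ?f j > 0 \<and> ?f j mod m = k} = {x \<in> {1..sum c {..<m}}. falling_word m c x = k}"
      unfolding S by (intro Collect_cong) (metis props(2,4))
    show ?thesis
    proof (cases "k < m")
      case False
      have "falling_word m c x \<noteq> k" for x
        using falling_word_less[of m c x] m False by linarith
      then have "{x \<in> {1..sum c {..<m}}. falling_word m c x = k} = {}" by simp
      then show ?thesis using * False assms by (simp add: balanced_pairs_def multiplicities_def)
    qed (simp only: * card_falling_word)
  qed
  ultimately show ?thesis by (simp add: quotient_residue_counts_def)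
qed

lemma partition_of_counts_mem:
  assumes "(a, c) \<in> balanced_pairs m n"
  shows "partition_of_counts m n (a, c) \<in> O_desc m n"
proof -
  note props = partition_of_counts_props[OF assms]
  let ?f = "partition_of_counts m n (a, c)"
  have "antimono_on {1..} ?f"
    by (auto simp: monotone_on_def partition_of_counts_def intro!: add_mono mult_le_mono2 falling_word_antimono)
  moreover have "finite {x. ?f x \<noteq> 0}"
    using props(4) by (auto intro: finite_subset[of _ "{1..sum a {..<n}}"])
  moreover have "\<not> m dvd ?f x" if "?f x > 0" for x
    using props[of x] that by (auto simp: dvd_eq_mod_eq_0)
  moreover have "antimono_on {j. ?f j > 0} (\<lambda>j. ?f j mod m)"
    using props(2,4) by (auto simp: monotone_on_def falling_word_antimono)
  moreover have "?f 1 < n * m"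
  proof -
    have "falling_word m c 1 < m" "Suc (falling_word n a 1) \<le> n"
      using falling_word_less[of m c 1] falling_word_less[of n a 1] m n by auto
    then have "?f 1 < m * Suc (falling_word n a 1)" "m * Suc (falling_word n a 1) \<le> m * n"
      by (auto simp: partition_of_counts_def mult_le_mono2 simp del: mult_Suc_right) simp
    then show ?thesis by (simp add: mult.commute)
  qed
  ultimately show ?thesis
    by (simp add: O_desc_def is_partition_def) (simp add: partition_of_counts_def)
qed

lemma bij_betw_O_desc:
  "bij_betw (quotient_residue_counts m) (O_desc m n) (balanced_pairs m n)"
  by (rule bij_betw_byWitness[where f' = "partition_of_counts m n"])
    (auto simp: partition_of_counts_inverse counts_partition_of_counts O_desc_counts_mem
      partition_of_counts_mem)

lemma weight_O_desc:
  assumes f: "f \<in> O_desc m n" and q: "quotient_residue_counts m f = (a, c)"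
  shows "weight f = m * (\<Sum>k<n. k * a k) + (\<Sum>i<m. i * c i)"
proof -
  let ?X = "{1..num_parts f}"
  have a: "a = (\<lambda>k. card {j \<in> ?X. f j div m = k})" and c: "c = (\<lambda>i. card {j \<in> ?X. f j mod m = i})"
    using q O_desc_counts[OF f] by auto
  have "weight f = (\<Sum>x\<in>?X. m * (f x div m) + f x mod m)"
    using f by (simp add: weight_partition O_desc_def)
  also have "\<dots> = m * (\<Sum>x\<in>?X. f x div m) + (\<Sum>x\<in>?X. f x mod m)"
    by (simp only: sum.distrib sum_distrib_left)
  also have "(\<Sum>x\<in>?X. f x div m) = (\<Sum>k<n. k * a k)"
    using sum_by_counts[of ?X "\<lambda>x. f x div m" n id] O_desc_quotient_less[OF f] a by simp
  also have "(\<Sum>x\<in>?X. f x mod m) = (\<Sum>i<m. i * c i)"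
    using sum_by_counts[of ?X "\<lambda>x. f x mod m" m id] m c by simp
  finally show ?thesis .
qed

end

section \<open>Block ends\<close>

lemma lecture_hall_strict:
  assumes "e \<in> lecture_hall n" "e r > 0"
  shows "e (Suc r) < e r"
proof -
  have "r < n" by (rule ccontr) (use assms in \<open>simp add: lecture_hall_def\<close>)
  then have "e (Suc r) * (n - r) \<le> e r * (n - Suc r)" "e r * (n - Suc r) < e r * (n - r)"
    using assms by (auto simp: lecture_hall_def)
  then have "e (Suc r) * (n - r) < e r * (n - r)" by linarith
  then show ?thesis by simp
qed

lemma lecture_hall_decreasing:
  assumes "e \<in> lecture_hall n"
  shows "e (Suc r) \<le> e r"
proof (cases "e r = 0")
  case True
  have "e (Suc r) * (n - r) \<le> e r * (n - Suc r)" "n \<le> Suc r \<longrightarrow> e (Suc r) = 0"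
    using assms by (auto simp: lecture_hall_def)
  with True have "e (Suc r) = 0" by (cases "n \<le> Suc r") auto
  with True show ?thesis by simp
qed (use lecture_hall_strict[OF assms, of r] in simp)

lemma block_end_even: "block_end m f (2 * i) = f (i * m + 1)"
  and block_end_odd: "block_end m f (Suc (2 * i)) = f (i * m + m)"
  by (simp_all add: block_end_def add.commute)

lemma block_end_decreasing:
  assumes p: "is_partition f" and m: "m \<ge> 1" and "r \<le> s"
  shows "block_end m f s \<le> block_end m f r"
  using \<open>r \<le> s\<close>
proof (induction s rule: dec_induct)
  case (step s)
  have "block_end m f (Suc s) \<le> block_end m f s"
  proof (cases "even s")
    case True
    then obtain i where "s = 2 * i" by auto
    then show ?thesis using m by (simp add: block_end_even[simplified] block_end_odd partition_antimono[OF p])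
  next
    case False
    then obtain i where s: "s = Suc (2 * i)" by (auto elim: oddE)
    have "block_end m f (Suc s) = f (i * m + m + 1)"
      using block_end_even[of m f "Suc i"] s by (simp add: add.commute)
    then show ?thesis using m s by (simp add: block_end_odd partition_antimono[OF p])
  qed
  with step show ?case by simp
qed simp

lemma num_parts_le_iff:
  assumes "is_partition f"
  shows "num_parts f \<le> k \<longleftrightarrow> f (Suc k) = 0"
  using partition_pos_iff[OF assms, of "Suc k"] by auto

text \<open>The bound on the number of parts is \<open>k * m\<close> for \<open>n = 2 * k\<close>
  and \<open>k * m + m - 1\<close> for \<open>n = 2 * k + 1\<close>. In both cases the next position
  is that of \<open>block_end m f n\<close>, so the bound says that this entry, and with it every
  later one, is 0.\<close>

lemma lecture_hall_block_end_iff: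
  assumes p: "is_partition f" and m: "m \<ge> 2"
  shows "num_parts f \<le> ((n + 1) div 2) * (m - 2) + n \<and> fraction_chain m n f \<longleftrightarrow>
    block_end m f \<in> lecture_hall n"
proof -
  let ?e = "block_end m f"
  have "f (Suc (((n + 1) div 2) * (m - 2) + n)) = ?e n"
  proof (cases "even n")
    case True
    then obtain k where k: "n = 2 * k" by auto
    have "k * (m - 2) + 2 * k = k * m" using m by (simp add: diff_mult_distrib2 mult.commute)
    then show ?thesis using block_end_even[of m f k] k by simp
  next
    case False
    then obtain k where k: "n = Suc (2 * k)" by (auto elim: oddE)
    obtain m' where m': "m = m' + 2" using m le_Suc_ex by (metis add.commute)
    have "Suc (Suc k * (m - 2) + Suc (2 * k)) = k * m + m" by (simp add: m' algebra_simps)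
    then show ?thesis using block_end_odd[of m f k] k by simp
  qed
  then have 1: "num_parts f \<le> ((n + 1) div 2) * (m - 2) + n \<longleftrightarrow> ?e n = 0"
    using num_parts_le_iff[OF p] by simp
  have 2: "?e n = 0 \<longleftrightarrow> (\<forall>r\<ge>n. ?e r = 0)"
    using block_end_decreasing[OF p, of m n] m by (metis One_nat_def Suc_1 Suc_leD le_0_eq order_refl)
  have 3: "((of_nat (?e r) / of_nat (n - r) :: rat) \<ge> of_nat (?e (r + 1)) / of_nat (n - (r + 1)))
      \<longleftrightarrow> ?e (Suc r) * (n - r) \<le> ?e r * (n - Suc r)" if "r + 1 < n" for r
  proof -
    have "(of_nat (n - r) :: rat) > 0" "(of_nat (n - (r + 1)) :: rat) > 0"
      using that by (simp_all add: of_nat_0_less_iff del: of_nat_diff)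
    then have "((of_nat (?e r) / of_nat (n - r) :: rat) \<ge> of_nat (?e (r + 1)) / of_nat (n - (r + 1)))
      \<longleftrightarrow> (of_nat (?e (r + 1)) * of_nat (n - r) :: rat) \<le> of_nat (?e r) * of_nat (n - (r + 1))"
      by (simp add: divide_le_eq le_divide_eq mult.commute del: of_nat_diff)
    also have "\<dots> \<longleftrightarrow> ?e (Suc r) * (n - r) \<le> ?e r * (n - Suc r)"
      unfolding of_nat_mult[symmetric] of_nat_le_iff by simp
    finally show ?thesis .
  qed
  show ?thesis
  proof (cases "?e n = 0")
    case True
    then have z: "\<forall>r\<ge>n. ?e r = 0" using 2 by simp
    have "fraction_chain m n f \<longleftrightarrow> (\<forall>r. r + 1 < n \<longrightarrow> ?e (Suc r) * (n - r) \<le> ?e r * (n - Suc r))"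
      unfolding fraction_chain_def using 3 True by blast
    also have "\<dots> \<longleftrightarrow> (\<forall>r. ?e (Suc r) * (n - r) \<le> ?e r * (n - Suc r))"
    proof -
      have "?e (Suc r) * (n - r) \<le> ?e r * (n - Suc r)" if "\<not> r + 1 < n" for r
        using z that by simp
      then show ?thesis by blast
    qed
    finally show ?thesis using 1 z True by (simp add: lecture_hall_def)
  next
    case False
    then show ?thesis using 1 by (auto simp: lecture_hall_def)
  qed
qed

text \<open>A positive value taken \<open>m\<close> times is taken on \<open>m\<close> consecutive
  positions. These contain the first and last part of one block or cross a block boundary, so two
  neighbouring entries of \<open>block_end m f\<close> agree, against
  \<open>lecture_hall_strict\<close>.\<close>

lemma lecture_hall_imp_D_mult:
  assumes p: "is_partition f" and m: "m \<ge> 2" and e: "block_end m f \<in> lecture_hall n"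
  shows "f \<in> D_mult m"
proof -
  have "card {j. f j = v} \<le> m - 1" if v: "v > 0" for v
  proof (rule ccontr)
    assume "\<not> card {j. f j = v} \<le> m - 1"
    then have c: "card {j. f j = v} \<ge> m" by simp
    let ?X = "{j. f j = v}"
    have fin: "finite ?X" and ne: "?X \<noteq> {}" using c m card_ge_0_finite[of ?X] by fastforce+
    let ?x = "Min ?X" and ?y = "Max ?X"
    have x: "f ?x = v" and y: "f ?y = v" using Min_in[OF fin ne] Max_in[OF fin ne] by auto
    have "card ?X \<le> card {?x..?y}" by (rule card_mono) (use fin in auto)
    then have le: "?x + (m - 1) \<le> ?y" using c m by simp
    have x1: "1 \<le> ?x" using x v p by (cases ?x) (auto simp: is_partition_def)
    have eq: "f z = v" if "?x \<le> z" "z \<le> ?x + (m - 1)" for z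
      using partition_antimono[OF p, of ?x z] partition_antimono[OF p, of z ?y] that le x y x1
      by simp
    define i where "i = (?x - 1) div m"
    define j where "j = (?x - 1) mod m"
    have xij: "?x = i * m + j + 1" using x1 unfolding i_def j_def by simp
    have j: "j < m" using m by (simp add: j_def)
    show False
    proof (cases "j = 0")
      case True
      then have "f (i * m + 1) = v" "f (i * m + m) = v" using xij m by (auto intro!: eq)
      then show False
        using lecture_hall_strict[OF e, of "2 * i"] v unfolding block_end_even block_end_odd by simp
    next
      case False
      then have "f (i * m + m) = v" "f (Suc i * m + 1) = v" using xij j by (auto intro!: eq)
      moreover have "block_end m f (Suc (Suc (2 * i))) = f (Suc i * m + 1)"
        using block_end_even[of m f "Suc i"] by simp
      ultimately show False
        using lecture_hall_strict[OF e, of "Suc (2 * i)"] v unfolding block_end_odd by simp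
    qed
  qed
  with p show ?thesis by (simp add: D_mult_def)
qed

text \<open>The condition \<open>lb\<^sub>i \<le> fb\<^sub>i\<^sub>+\<^sub>1\<close> of the paper, extended to nonadjacent blocks: a block that
  descends at or before position \<open>j\<close> leaves no descents after \<open>j\<close> in the earlier blocks.\<close>

definition full_before_later :: "nat \<Rightarrow> (nat \<Rightarrow> nat) \<Rightarrow> bool" where
  "full_before_later m f \<longleftrightarrow> (\<forall>i i' j. i < i' \<longrightarrow> j < m \<longrightarrow>
     f (i' * m + j + 1) < f (i' * m + 1) \<longrightarrow> f (i * m + j + 1) = f (i * m + m))"

lemma block_antimono:
  assumes "is_partition f" "j \<le> k" "1 \<le> j"
  shows "f (i * m + k) \<le> f (i * m + j)"
  by (rule partition_antimono) (use assms in auto)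

text \<open>In adjacent blocks, to have left the first part at position \<open>j + 1\<close> means
  \<open>fb \<le> j\<close>, and to have reached the last part there means
  \<open>lb \<le> j\<close>. Strictness inside nonzero blocks carries the implication across the
  blocks in between.\<close>

lemma lb_le_fb_iff:
  assumes p: "is_partition f" and m: "m \<ge> 2" and e: "block_end m f \<in> lecture_hall n"
  shows "(\<forall>i < (num_parts f - 1) div m. lb m f i \<le> fb m f (i + 1)) \<longleftrightarrow> full_before_later m f"
proof
  have strict: "f (i * m + m) < f (i * m + 1)" if "f (i * m + 1) > 0" for i
    using lecture_hall_strict[OF e, of "2 * i"] that by (simp only: block_end_even block_end_odd)
  have fb_in: "f (i * m + fb m f i) = f (i * m + 1)" "1 \<le> fb m f i" "fb m f i \<le> m" for i
  proof -
    have "fb m f i \<in> {j \<in> {1..m}. f (i * m + j) = f (i * m + 1)}"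
      unfolding fb_def by (rule Max_in) (use m in \<open>auto intro!: exI[of _ 1]\<close>)
    then show "f (i * m + fb m f i) = f (i * m + 1)" "1 \<le> fb m f i" "fb m f i \<le> m" by auto
  qed
  have blk: "f (Suc i * m + 1) > 0 \<longleftrightarrow> i < (num_parts f - 1) div m" for i
  proof -
    have "f (Suc i * m + 1) > 0 \<longleftrightarrow> Suc i * m \<le> num_parts f - 1"
      using partition_pos_iff[OF p, of "Suc i * m + 1"] m by auto
    also have "\<dots> \<longleftrightarrow> Suc i \<le> (num_parts f - 1) div m"
      using m by (subst less_eq_div_iff_mult_less_eq) auto
    finally show ?thesis by (simp add: Suc_le_eq)
  qed
  show "full_before_later m f" if *: "\<forall>i < (num_parts f - 1) div m. lb m f i \<le> fb m f (i + 1)"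
  proof -
    have adj: "f (i * m + j + 1) = f (i * m + m)"
      if "j < m" "f (Suc i * m + j + 1) < f (Suc i * m + 1)" for i j
    proof (rule ccontr)
      assume ne: "f (i * m + j + 1) \<noteq> f (i * m + m)"
      have "f (i * m + m) \<le> f (i * m + j + 1)"
        using block_antimono[OF p, of "j + 1" m i] that by (simp add: add.assoc)
      with ne that have "j + 1 \<in> {k \<in> {1..m}. f (i * m + k) > f (i * m + m)}"
        by (auto simp: add.assoc)
      then have "j + 1 \<le> lb m f i" unfolding lb_def by (intro Max_ge) auto
      moreover have "lb m f i \<le> fb m f (i + 1)" using * blk[of i] that(2) by auto
      moreover have "fb m f (Suc i) \<le> j"
      proof (rule ccontr)
        assume "\<not> fb m f (Suc i) \<le> j"
        then have "f (Suc i * m + fb m f (Suc i)) \<le> f (Suc i * m + (j + 1))"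
          by (intro block_antimono[OF p]) auto
        then show False using fb_in(1)[of "Suc i"] that(2) by (simp add: add.assoc)
      qed
      ultimately show False by simp
    qed
    have "f (i * m + j + 1) = f (i * m + m)"
      if "Suc i \<le> i'" "j < m" "f (i' * m + j + 1) < f (i' * m + 1)" for i i' j
      using that
    proof (induction i' rule: dec_induct)
      case base
      then show ?case using adj by blast
    next
      case (step k)
      \<comment> \<open>Block \<open>k\<close> has reached its last part here, which is less than
        its first because the block is nonzero. So block \<open>k\<close> has descended as well and
        the induction hypothesis applies to it.\<close>
      have eq: "f (k * m + j + 1) = f (k * m + m)" by (rule adj) (use step in auto)
      have "f (Suc k * m + 1) \<le> f (k * m + 1)"
        by (rule partition_antimono[OF p]) auto
      then have "f (k * m + 1) > 0" using step.prems(2) by linarith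
      then show ?case using step.IH step.prems(1) strict[of k] eq by simp
    qed
    then show ?thesis unfolding full_before_later_def Suc_le_eq by blast
  qed
  show "\<forall>i < (num_parts f - 1) div m. lb m f i \<le> fb m f (i + 1)" if *: "full_before_later m f"
  proof (intro allI impI)
    fix i assume "i < (num_parts f - 1) div m"
    then have "f (Suc i * m + 1) > 0" by (simp only: blk)
    moreover have "f (Suc i * m + 1) \<le> f (i * m + 1)"
      by (rule partition_antimono[OF p]) auto
    ultimately have st: "f (i * m + m) < f (i * m + 1)" using strict by force
    have "k \<le> fb m f (Suc i)" if k: "k \<in> {1..m}" "f (i * m + k) > f (i * m + m)" for k
    proof (rule ccontr)
      assume gt: "\<not> k \<le> fb m f (Suc i)"
      \<comment> \<open>Position \<open>?j + 1\<close> is the first at which block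
        \<open>Suc i\<close> has dropped, and block \<open>i\<close> would still be above its last
        part at \<open>k \<ge> ?j + 1\<close>.\<close>
      let ?j = "fb m f (Suc i)"
      have "f (Suc i * m + (?j + 1)) \<noteq> f (Suc i * m + 1)"
      proof
        assume "f (Suc i * m + (?j + 1)) = f (Suc i * m + 1)"
        then have "?j + 1 \<in> {j \<in> {1..m}. f (Suc i * m + j) = f (Suc i * m + 1)}"
          using gt k by simp
        then have "?j + 1 \<le> fb m f (Suc i)"
          unfolding fb_def[of m f "Suc i"] by (intro Max_ge) simp
        then show False by simp
      qed
      moreover have "f (Suc i * m + (?j + 1)) \<le> f (Suc i * m + 1)"
        by (intro block_antimono[OF p]) auto
      ultimately have "f (i * m + ?j + 1) = f (i * m + m)"
        using *[unfolded full_before_later_def, rule_format, of i "Suc i" ?j] gt k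
        by (simp add: add.assoc)
      moreover have "f (i * m + k) \<le> f (i * m + (?j + 1))"
        using gt by (intro block_antimono[OF p]) auto
      ultimately show False using k by (simp add: add.assoc)
    qed
    moreover have "finite {k \<in> {1..m}. f (i * m + k) > f (i * m + m)}"
      "1 \<in> {k \<in> {1..m}. f (i * m + k) > f (i * m + m)}" using st m by auto
    ultimately show "lb m f i \<le> fb m f (i + 1)"
      unfolding lb_def by (intro Max.boundedI) auto
  qed
qed

lemma L_desc_iff:
  assumes "m \<ge> 2"
  shows "f \<in> L_desc m n \<longleftrightarrow>
    is_partition f \<and> block_end m f \<in> lecture_hall n \<and> full_before_later m f"
proof (cases "is_partition f \<and> block_end m f \<in> lecture_hall n")
  case True
  then show ?thesis
    using lecture_hall_block_end_iff[of f m n] lb_le_fb_iff[of f m n] lecture_hall_imp_D_mult[of f m n] assms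
    by (auto simp: L_desc_def)
next
  case False
  then show ?thesis
    using lecture_hall_block_end_iff[of f m n] assms by (auto simp: L_desc_def D_mult_def)
qed

section \<open>Distribution of the descents inside blocks\<close>

text \<open>The number of unit descents that fit inside the first \<open>i\<close> blocks when block
  \<open>k\<close> starts with \<open>e (2 * k)\<close> and ends with
  \<open>e (Suc (2 * k))\<close>.\<close>

definition full_length :: "(nat \<Rightarrow> nat) \<Rightarrow> nat \<Rightarrow> nat" where
  "full_length e i = (\<Sum>k<i. e (2 * k) - e (Suc (2 * k)))"

text \<open>What block \<open>i\<close> receives when \<open>x\<close> unit descents fill the blocks
  in order.\<close>

definition clip :: "(nat \<Rightarrow> nat) \<Rightarrow> nat \<Rightarrow> nat \<Rightarrow> nat" where
  "clip e i x = min x (full_length e (Suc i)) - min x (full_length e i)"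

lemma full_length_mono: "i \<le> j \<Longrightarrow> full_length e i \<le> full_length e j"
  unfolding full_length_def by (rule sum_mono2) auto

lemma full_length_Suc: "full_length e (Suc i) = full_length e i + (e (2 * i) - e (Suc (2 * i)))"
  by (simp add: full_length_def)

lemma clip_mono: "x \<le> y \<Longrightarrow> clip e i x \<le> clip e i y"
  using full_length_Suc[of e i] unfolding clip_def by linarith

lemma sum_clip: "(\<Sum>i<k. clip e i x) = min x (full_length e k)"
proof (induction k)
  case (Suc k)
  then show ?case using full_length_Suc[of e k] by (simp add: clip_def)
qed (simp add: full_length_def)

text \<open>If \<open>d i\<close> is positive, all earlier blocks are full; if it is below the
  capacity of block \<open>i\<close>, all later ones are empty. So the total alone determines the
  distribution.\<close>

lemma clip_of_greedy:
  assumes le: "\<And>i. d i \<le> e (2 * i) - e (Suc (2 * i))"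
    and greedy: "\<And>i i'. i < i' \<Longrightarrow> d i' > 0 \<Longrightarrow> d i = e (2 * i) - e (Suc (2 * i))"
    and i: "i < n"
  shows "d i = clip e i (\<Sum>k<n. d k)"
proof -
  let ?N = "\<lambda>i. e (2 * i) - e (Suc (2 * i))"
  have split: "(\<Sum>k<n. d k) = (\<Sum>k<i. d k) + d i + (\<Sum>k\<in>{Suc i..<n}. d k)"
  proof -
    have "{..<n} = {..<i} \<union> {i} \<union> {Suc i..<n}" using i by auto
    then have "(\<Sum>k<n. d k) = (\<Sum>k\<in>{..<i} \<union> {i} \<union> {Suc i..<n}. d k)" by simp
    also have "\<dots> = (\<Sum>k<i. d k) + d i + (\<Sum>k\<in>{Suc i..<n}. d k)"
      by (subst sum.union_disjoint; auto)+
    finally show ?thesis .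
  qed
  have before_le: "(\<Sum>k<i. d k) \<le> full_length e i"
    unfolding full_length_def by (rule sum_mono) (rule le)
  have after: "(\<Sum>k\<in>{Suc i..<n}. d k) = 0" if "d i < ?N i"
  proof -
    have "d k = 0" if "k \<in> {Suc i..<n}" for k
      using greedy[of i k] \<open>d i < ?N i\<close> that by (cases "d k = 0") auto
    then show ?thesis by simp
  qed
  have before: "(\<Sum>k<i. d k) = full_length e i" if "d i > 0"
    unfolding full_length_def using greedy[OF _ that] by (intro sum.cong) auto
  note S = full_length_Suc[of e i]
  show ?thesis
  proof (cases "d i = 0")
    case True
    then show ?thesis
      using after before_le split S unfolding clip_def by (cases "?N i = 0") auto
  next
    case False
    then show ?thesis
      using after before split S le[of i] unfolding clip_def by (cases "d i < ?N i") auto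
  qed
qed

definition profile :: "nat \<Rightarrow> (nat \<Rightarrow> nat) \<Rightarrow> (nat \<Rightarrow> nat) \<times> (nat \<Rightarrow> nat)" where
  "profile m f = (block_end m f, \<lambda>i. if 1 \<le> i \<and> i < m then alt_sum m i f else 0)"

definition profiles :: "nat \<Rightarrow> nat \<Rightarrow> ((nat \<Rightarrow> nat) \<times> (nat \<Rightarrow> nat)) set" where
  "profiles m n = {(e, c). e \<in> lecture_hall n \<and> c \<in> multiplicities m \<and> c 0 = 0 \<and>
     sum c {..<m} + odd_sum n e = even_sum n e}"

text \<open>The descents inside blocks, read from the first block on, have nondecreasing positions.
  Hence block \<open>b\<close> takes those numbered from \<open>full_length e b\<close> to \<open>full_length e (Suc b)\<close> in the
  sorted list of all positions, and \<open>clip\<close> counts the ones among them at positions \<open>\<le> j\<close>.\<close>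

definition partition_of_profile ::
    "nat \<Rightarrow> (nat \<Rightarrow> nat) \<times> (nat \<Rightarrow> nat) \<Rightarrow> nat \<Rightarrow> nat" where
  "partition_of_profile m p x = (if x = 0 then 0 else
     fst p (2 * ((x - 1) div m)) - clip (fst p) ((x - 1) div m) (sum (snd p) {..(x - 1) mod m}))"

lemma partition_of_profile_eq:
  "j < m \<Longrightarrow> partition_of_profile m (e, c) (b * m + j + 1) = e (2 * b) - clip e b (sum c {..j})"
  by (simp add: partition_of_profile_def)

text \<open>Summation by parts. The factor \<open>i\<close> removes the term at 0, where
  \<open>h\<close> may increase; this happens in block 0, whose first part is preceded by
  \<open>f 0 = 0\<close>.\<close>

lemma sum_by_summation:
  fixes h :: "nat \<Rightarrow> nat"
  assumes "\<And>i. 1 \<le> i \<Longrightarrow> h (Suc i) \<le> h i"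
  shows "(\<Sum>j<k. h (Suc j)) = k * h k + (\<Sum>i<k. i * (h i - h (Suc i)))"
proof (induction k)
  case (Suc k)
  show ?case
  proof (cases "k = 0")
    case False
    then obtain d where d: "h k = h (Suc k) + d" using assms[of k] le_Suc_ex by auto
    show ?thesis using Suc by (simp add: d algebra_simps)
  qed simp
qed simp

section \<open>Partitions in \<open>L_desc\<close> and their profiles\<close>

context
  fixes m n :: nat
  assumes m: "m \<ge> 2"
begin

lemma even_odd_sum_diff:
  assumes "e \<in> lecture_hall n"
  shows "full_length e n + odd_sum n e = even_sum n e"
  unfolding full_length_def odd_sum_def even_sum_def sum.distrib[symmetric]
  by (rule sum.cong) (use lecture_hall_decreasing[OF assms] in auto)

lemma alt_sum_eq:
  assumes p: "is_partition f" and e: "block_end m f \<in> lecture_hall n" and i: "1 \<le> i"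
  shows "alt_sum m i f = (\<Sum>b<n. f (b * m + i) - f (b * m + i + 1))"
  unfolding alt_sum_def
proof (rule Sum_any.expand_superset)
  show "{b. f (b * m + i) - f (b * m + i + 1) \<noteq> 0} \<subseteq> {..<n}"
  proof (rule subsetI, rule ccontr)
    fix b assume b: "b \<in> {b. f (b * m + i) - f (b * m + i + 1) \<noteq> 0}" "b \<notin> {..<n}"
    then have "f (b * m + 1) = 0"
      using e block_end_even[of m f b] by (simp add: lecture_hall_def)
    moreover have "f (b * m + i) \<le> f (b * m + 1)" by (rule partition_antimono[OF p]) (use i in auto)
    ultimately show False using b by simp
  qed
qed simp

text \<open>The sum telescopes inside each block: it counts the unit descents at positions up to
  \<open>j\<close>, the argument that \<open>partition_of_profile\<close> passes to
  \<open>clip\<close>.\<close>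

lemma profile_prefix_sum:
  assumes p: "is_partition f" and e: "block_end m f \<in> lecture_hall n" and j: "j < m"
  shows "sum (snd (profile m f)) {..j} = (\<Sum>b<n. f (b * m + 1) - f (b * m + j + 1))"
  using j
proof (induction j)
  case (Suc j)
  have "sum (snd (profile m f)) {..Suc j} = (\<Sum>b<n. (f (b * m + 1) - f (b * m + j + 1)) +
      (f (b * m + j + 1) - f (b * m + j + 1 + 1)))"
    using Suc alt_sum_eq[OF p e, of "Suc j"] by (simp add: profile_def sum.distrib)
  also have "\<dots> = (\<Sum>b<n. f (b * m + 1) - f (b * m + Suc j + 1))"
  proof (rule sum.cong)
    fix b
    have "f (b * m + j + 1) \<le> f (b * m + 1)" "f (b * m + j + 1 + 1) \<le> f (b * m + j + 1)"
      by (auto intro: partition_antimono[OF p])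
    then show "(f (b * m + 1) - f (b * m + j + 1)) + (f (b * m + j + 1) - f (b * m + j + 1 + 1)) =
        f (b * m + 1) - f (b * m + Suc j + 1)" by simp
  qed simp
  finally show ?case .
qed (simp add: profile_def)

lemma profile_mem:
  assumes f: "f \<in> L_desc m n"
  shows "profile m f \<in> profiles m n"
proof -
  have p: "is_partition f" and e: "block_end m f \<in> lecture_hall n"
    using f L_desc_iff[OF m] by auto
  have m1: "{..<m} = {..m - 1}" "m - 1 < m" using m by auto
  have "sum (snd (profile m f)) {..<m} = (\<Sum>b<n. f (b * m + 1) - f (b * m + (m - 1) + 1))"
    unfolding m1(1) by (rule profile_prefix_sum[OF p e m1(2)])
  also have "\<dots> = full_length (block_end m f) n"
    unfolding full_length_def block_end_even block_end_odd using m by (simp add: add.assoc)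
  finally show ?thesis
    using even_odd_sum_diff[OF e] e by (auto simp: profiles_def profile_def multiplicities_def)
qed

text \<open>For fixed \<open>j\<close> the drops \<open>f (b * m + 1) - f (b * m + j + 1)\<close>
  fill the blocks in order, by \<open>full_before_later\<close>. Hence \<open>clip_of_greedy\<close>
  recovers them from their sum, which is a prefix sum of the profile.\<close>

lemma partition_of_profile_inverse:
  assumes f: "f \<in> L_desc m n"
  shows "partition_of_profile m (profile m f) = f"
proof
  fix x
  let ?e = "block_end m f"
  define c where "c = snd (profile m f)"
  have p: "is_partition f" and e: "?e \<in> lecture_hall n" and g: "full_before_later m f"
    using f L_desc_iff[OF m] by auto
  have pr: "profile m f = (?e, c)" by (simp add: profile_def c_def)
  show "partition_of_profile m (profile m f) x = f x"
  proof (cases "x = 0")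
    case True
    then show ?thesis using p by (simp add: partition_of_profile_def is_partition_def)
  next
    case False
    define b where "b = (x - 1) div m"
    define j where "j = (x - 1) mod m"
    have x: "x = b * m + j + 1" and j: "j < m" using False m by (simp_all add: b_def j_def)
    have le: "f x \<le> f (b * m + 1)" by (rule partition_antimono[OF p]) (auto simp: x)
    have "partition_of_profile m (profile m f) x = ?e (2 * b) - clip ?e b (sum c {..j})"
      unfolding x pr by (rule partition_of_profile_eq[OF j])
    also have "\<dots> = f x"
    proof (cases "b < n")
      case True
      have "f (b * m + 1) - f (b * m + j + 1) = clip ?e b (\<Sum>b<n. f (b * m + 1) - f (b * m + j + 1))"
      proof (rule clip_of_greedy[OF _ _ True])
        fix i
        have "f (i * m + m) \<le> f (i * m + j + 1)" by (rule partition_antimono[OF p]) (use j in auto)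
        then show "f (i * m + 1) - f (i * m + j + 1) \<le> ?e (2 * i) - ?e (Suc (2 * i))"
          unfolding block_end_even block_end_odd by linarith
      next
        fix i i' assume "i < i'" "f (i' * m + 1) - f (i' * m + j + 1) > 0"
        then have "f (i * m + j + 1) = f (i * m + m)"
          using g j by (simp add: full_before_later_def)
        then show "f (i * m + 1) - f (i * m + j + 1) = ?e (2 * i) - ?e (Suc (2 * i))"
          unfolding block_end_even block_end_odd by simp
      qed
      then show ?thesis using le unfolding c_def profile_prefix_sum[OF p e j] block_end_even x by linarith
    next
      case False
      then have "?e (2 * b) = 0" using e by (simp add: lecture_hall_def)
      then show ?thesis using le unfolding block_end_even by simp
    qed
    finally show ?thesis .
  qed
qed

text \<open>At offset 0 the prefix sum is \<open>c 0 = 0\<close> and nothing is subtracted; at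
  offset \<open>m - 1\<close> it is the full total, so each block drops by its whole
  capacity.\<close>

lemma partition_of_profile_block_end:
  assumes "(e, c) \<in> profiles m n"
  shows "block_end m (partition_of_profile m (e, c)) = e"
proof
  fix r
  let ?g = "partition_of_profile m (e, c)"
  have e: "e \<in> lecture_hall n" and c0: "c 0 = 0" and tot: "sum c {..<m} = full_length e n"
    using assms even_odd_sum_diff[of e] by (auto simp: profiles_def)
  show "block_end m ?g r = e r"
  proof (cases "even r")
    case True
    then obtain b where r: "r = 2 * b" by auto
    show ?thesis unfolding r block_end_even
      using partition_of_profile_eq[of 0 m e c b] m c0 by (simp add: clip_def)
  next
    case False
    then obtain b where r: "r = Suc (2 * b)" by (auto elim: oddE)
    have "full_length e (Suc b) \<le> full_length e n"
    proof (cases "b < n")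
      case False
      then have "full_length e (Suc b) = full_length e n"
        unfolding full_length_def by (intro sum.mono_neutral_right) (use e in \<open>auto simp: lecture_hall_def\<close>)
      then show ?thesis by simp
    qed (simp add: full_length_mono)
    moreover have "sum c {..m - 1} = full_length e n"
      using tot m by (simp add: lessThan_Suc_atMost[symmetric])
    ultimately have "clip e b (sum c {..m - 1}) = e (2 * b) - e (Suc (2 * b))"
      using full_length_Suc[of e b] unfolding clip_def by linarith
    then show ?thesis unfolding r block_end_odd
      using partition_of_profile_eq[of "m - 1" m e c b] m lecture_hall_decreasing[OF e, of "2 * b"]
      by (simp add: add.assoc)
  qed
qed

lemma partition_of_profile_is_partition:
  assumes "(e, c) \<in> profiles m n"
  shows "is_partition (partition_of_profile m (e, c))"
proof -
  let ?g = "partition_of_profile m (e, c)"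
  have e: "e \<in> lecture_hall n" using assms by (auto simp: profiles_def)
  note be = partition_of_profile_block_end[OF assms]
  have coord: "\<exists>b j. j < m \<and> x = b * m + j + 1" if "x \<ge> 1" for x
    using that m by (intro exI[of _ "(x - 1) div m"] exI[of _ "(x - 1) mod m"]) auto
  have decr: "?g (Suc x) \<le> ?g x" if x1: "x \<ge> 1" for x
  proof -
    obtain b j where j: "j < m" and x: "x = b * m + j + 1" using coord[OF x1] by blast
    show ?thesis
    proof (cases "Suc j < m")
      case True
      have "clip e b (sum c {..j}) \<le> clip e b (sum c {..Suc j})" by (rule clip_mono) simp
      then show ?thesis
        using partition_of_profile_eq[OF j, of e c b] partition_of_profile_eq[OF True, of e c b] x by simp
    next
      case False
      then have x: "Suc x = Suc b * m + 1" "x = b * m + m" using x j by auto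
      have "?g (Suc x) = e (Suc (Suc (2 * b)))"
        unfolding x(1) using block_end_even[of m ?g "Suc b"] be by simp
      moreover have "?g x = e (Suc (2 * b))"
        unfolding x(2) using block_end_odd[of m ?g b] be by simp
      ultimately show ?thesis using lecture_hall_decreasing[OF e, of "Suc (2 * b)"] by simp
    qed
  qed
  have "?g y \<le> ?g x" if "1 \<le> x" "x \<le> y" for x y
    using that(2)
  proof (induction y rule: dec_induct)
    case (step y)
    then show ?case using decr[of y] that(1) by linarith
  qed simp
  moreover have "{x. ?g x \<noteq> 0} \<subseteq> {..n * m}"
  proof (rule subsetI, rule ccontr)
    fix x assume x: "x \<in> {x. ?g x \<noteq> 0}" "x \<notin> {..n * m}"
    have "\<not> (x - 1) div m < n" using x m by (subst div_less_iff_less_mult) auto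
    then show False using x e by (simp add: partition_of_profile_def lecture_hall_def)
  qed
  ultimately show ?thesis
    unfolding is_partition_def monotone_on_def
    by (auto simp: finite_subset partition_of_profile_def[of m _ 0])
qed

lemma partition_of_profile_mem:
  assumes "(e, c) \<in> profiles m n"
  shows "partition_of_profile m (e, c) \<in> L_desc m n"
proof -
  let ?g = "partition_of_profile m (e, c)"
  have e: "e \<in> lecture_hall n" and c0: "c 0 = 0" using assms by (auto simp: profiles_def)
  note be = partition_of_profile_block_end[OF assms]
  have "?g (i * m + j + 1) = ?g (i * m + m)"
    if "i < i'" "j < m" "?g (i' * m + j + 1) < ?g (i' * m + 1)" for i i' j
  proof -
    have "?g (i' * m + 1) = e (2 * i')" "?g (i * m + m) = e (Suc (2 * i))"
      using block_end_even[of m ?g i'] block_end_odd[of m ?g i] be by auto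
    note eqs = this partition_of_profile_eq[OF \<open>j < m\<close>, of e c]
    \<comment> \<open>A drop in block \<open>i'\<close> means that the prefix sum exceeds the
      capacity of all blocks before it, so these are full at the same offset.\<close>
    have "clip e i' (sum c {..j}) > 0" using that(3) unfolding eqs by simp
    then have "sum c {..j} > full_length e i'" by (auto simp: clip_def)
    moreover have "full_length e (Suc i) \<le> full_length e i'"
      using that(1) by (intro full_length_mono) simp
    ultimately have "clip e i (sum c {..j}) = e (2 * i) - e (Suc (2 * i))"
      using full_length_Suc[of e i] unfolding clip_def by linarith
    then show ?thesis unfolding eqs using lecture_hall_decreasing[OF e, of "2 * i"] by simp
  qed
  then have "full_before_later m ?g" unfolding full_before_later_def by blast
  then show ?thesis
    using L_desc_iff[OF m] partition_of_profile_is_partition[OF assms] be e by simp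
qed

text \<open>The clipped prefix sums add up over all blocks to the prefix sum itself, which never
  exceeds the total capacity; equal prefix sums give equal entries.\<close>

lemma profile_partition_of_profile:
  assumes "(e, c) \<in> profiles m n"
  shows "profile m (partition_of_profile m (e, c)) = (e, c)"
proof -
  let ?g = "partition_of_profile m (e, c)"
  let ?c = "snd (profile m ?g)"
  have e: "e \<in> lecture_hall n" and c0: "c 0 = 0" and cm: "c \<in> multiplicities m"
    and tot: "sum c {..<m} = full_length e n"
    using assms even_odd_sum_diff[of e] by (auto simp: profiles_def)
  note p = partition_of_profile_is_partition[OF assms]
  note be = partition_of_profile_block_end[OF assms]
  have prefix: "sum ?c {..j} = sum c {..j}" if j: "j < m" for j
  proof -
    have "sum ?c {..j} = (\<Sum>b<n. ?g (b * m + 1) - ?g (b * m + j + 1))"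
      by (rule profile_prefix_sum[OF p _ j]) (simp add: be e)
    also have "\<dots> = (\<Sum>b<n. clip e b (sum c {..j}))"
    proof (rule sum.cong)
      fix b
      have "?g (b * m + 1) = e (2 * b)" using block_end_even[of m ?g b] be by simp
      moreover have "?g (b * m + m) = e (Suc (2 * b))" using block_end_odd[of m ?g b] be by simp
      moreover have "clip e b (sum c {..j}) \<le> e (2 * b)"
        using full_length_Suc[of e b] unfolding clip_def by linarith
      ultimately show "?g (b * m + 1) - ?g (b * m + j + 1) = clip e b (sum c {..j})"
        using partition_of_profile_eq[OF j, of e c b] by simp
    qed simp
    also have "\<dots> = min (sum c {..j}) (full_length e n)" by (rule sum_clip)
    also have "\<dots> = sum c {..j}"
      unfolding tot[symmetric] using j by (intro min_absorb1 sum_mono2) auto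
    finally show ?thesis .
  qed
  have "?c i = c i" for i
  proof (cases "i < m")
    case True
    show ?thesis
    proof (cases i)
      case (Suc j)
      then show ?thesis using prefix[of j] prefix[of i] True by simp
    qed (simp add: profile_def c0)
  next
    case False
    then show ?thesis using cm by (simp add: profile_def multiplicities_def)
  qed
  then show ?thesis by (simp add: profile_def be fun_eq_iff)
qed

lemma bij_betw_L_desc: "bij_betw (profile m) (L_desc m n) (profiles m n)"
  by (rule bij_betw_byWitness[where f' = "partition_of_profile m"])
    (auto simp: partition_of_profile_inverse profile_partition_of_profile profile_mem
      partition_of_profile_mem)

text \<open>Summation by parts in a block gives \<open>m\<close> times its last part plus each
  descent weighted by its position. The last parts are the odd entries of \<open>e\<close>, and the
  descents at position \<open>i\<close> add up to \<open>c i\<close>.\<close>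

lemma weight_L_desc:
  assumes f: "f \<in> L_desc m n" and q: "profile m f = (e, c)"
  shows "weight f = m * odd_sum n e + (\<Sum>i<m. i * c i)"
proof -
  have p: "is_partition f" and le: "block_end m f \<in> lecture_hall n"
    using f L_desc_iff[OF m] by auto
  have eq: "e = block_end m f" and c: "c = (\<lambda>i. if 1 \<le> i \<and> i < m then alt_sum m i f else 0)"
    using q by (auto simp: profile_def)
  have np: "num_parts f \<le> n * m"
    using num_parts_le_iff[OF p, of "n * m"] block_end_even[of m f n] le by (simp add: lecture_hall_def)
  have "weight f = (\<Sum>x\<in>{1..n * m}. f x)"
    unfolding weight_partition[OF p]
  proof (rule sum.mono_neutral_left)
    show "\<forall>x\<in>{1..n * m} - {1..num_parts f}. f x = 0" using partition_pos_iff[OF p] by force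
  qed (use np in auto)
  also have "\<dots> = (\<Sum>x<n * m. f (Suc x))"
    by (simp add: sum.atLeast1_atMost_eq)
  also have "\<dots> = (\<Sum>b<n. \<Sum>x\<in>{b * m..<b * m + m}. f (Suc x))"
    by (rule sum.nat_group[symmetric])
  also have "\<dots> = (\<Sum>b<n. m * f (b * m + m) + (\<Sum>i<m. i * (f (b * m + i) - f (b * m + i + 1))))"
  proof (rule sum.cong)
    fix b
    have "(\<Sum>x\<in>{b * m..<b * m + m}. f (Suc x)) = (\<Sum>j<m. f (b * m + Suc j))"
      by (rule sum.reindex_bij_witness[of _ "\<lambda>j. b * m + j" "\<lambda>x. x - b * m"]) auto
    also have "\<dots> = m * f (b * m + m) + (\<Sum>i<m. i * (f (b * m + i) - f (b * m + Suc i)))"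
      by (rule sum_by_summation) (auto intro: partition_antimono[OF p])
    finally show "(\<Sum>x\<in>{b * m..<b * m + m}. f (Suc x)) =
        m * f (b * m + m) + (\<Sum>i<m. i * (f (b * m + i) - f (b * m + i + 1)))" by simp
  qed simp
  also have "\<dots> = m * odd_sum n e + (\<Sum>b<n. \<Sum>i<m. i * (f (b * m + i) - f (b * m + i + 1)))"
    unfolding eq odd_sum_def Suc_eq_plus1[symmetric] block_end_odd
    by (simp add: sum.distrib sum_distrib_left)
  also have "(\<Sum>b<n. \<Sum>i<m. i * (f (b * m + i) - f (b * m + i + 1))) = (\<Sum>i<m. i * c i)"
    by (subst sum.swap, rule sum.cong[OF refl])
      (auto simp: c alt_sum_eq[OF p le] sum_distrib_left)
  finally show ?thesis .
qed

end

section \<open>Generating functions\<close>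

text \<open>Each coefficient of the finite partial sums is constant once the finitely many
  contributing indices are included.\<close>

lemma summable_on_fps:
  fixes f :: "'b \<Rightarrow> 'a::ab_group_add fps"
  assumes "\<And>k. finite {x \<in> A. fps_nth (f x) k \<noteq> 0}"
  shows "f summable_on A"
proof -
  define G where "G = Abs_fps (\<lambda>k. \<Sum>x | x \<in> A \<and> fps_nth (f x) k \<noteq> 0. fps_nth (f x) k)"
  have "(sum f \<longlongrightarrow> G) (finite_subsets_at_top A)"
  proof (rule tendsto_fpsI)
    fix k
    show "\<forall>\<^sub>F X in finite_subsets_at_top A. fps_nth (sum f X) k = fps_nth G k"
      unfolding eventually_finite_subsets_at_top
    proof (intro exI[of _ "{x \<in> A. fps_nth (f x) k \<noteq> 0}"] conjI allI impI)
      fix X assume "finite X \<and> {x \<in> A. fps_nth (f x) k \<noteq> 0} \<subseteq> X \<and> X \<subseteq> A"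
      then show "fps_nth (sum f X) k = fps_nth G k"
        unfolding fps_sum_nth G_def fps_nth_Abs_fps by (intro sum.mono_neutral_right) auto
    qed (use assms in auto)
  qed
  then show ?thesis by (auto simp: summable_on_def has_sum_def)
qed

text \<open>The common form of \<open>L_term\<close> and \<open>O_term\<close> once both sums run
  over \<open>balanced_pairs\<close>.\<close>

definition pair_term :: "nat \<Rightarrow> nat \<Rightarrow> (nat \<Rightarrow> nat) \<times> (nat \<Rightarrow> nat) \<Rightarrow> qz_series" where
  "pair_term m n p = (\<Prod>i = 1..m - 1. z_var i ^ snd p i) *
     q_var ^ (m * (\<Sum>k<n. k * fst p k) + (\<Sum>i<m. i * snd p i))"

text \<open>The weight does not contain \<open>a 0\<close>; this entry is bounded through
  \<open>sum a {..<n} = sum c {..<m}\<close>, where \<open>c i \<le> i * c i\<close> for all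
  \<open>i\<close> because \<open>c 0 = 0\<close>.\<close>

lemma finite_balanced_pairs:
  "finite {p \<in> balanced_pairs m n. m * (\<Sum>k<n. k * fst p k) + (\<Sum>i<m. i * snd p i) = w}"
proof (rule finite_subset)
  let ?F = "\<lambda>N. {f :: nat \<Rightarrow> nat. \<forall>x. (x \<in> {..<N} \<longrightarrow> f x \<in> {..w}) \<and> (x \<notin> {..<N} \<longrightarrow> f x = 0)}"
  show "finite (?F n \<times> ?F m)"
    by (intro finite_cartesian_product finite_set_of_finite_funs) auto
  show "{p \<in> balanced_pairs m n. m * (\<Sum>k<n. k * fst p k) + (\<Sum>i<m. i * snd p i) = w} \<subseteq> ?F n \<times> ?F m"
  proof
    fix p assume p: "p \<in> {p \<in> balanced_pairs m n. m * (\<Sum>k<n. k * fst p k) + (\<Sum>i<m. i * snd p i) = w}"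
    obtain a c where pac: "p = (a, c)" by force
    have ac: "a \<in> multiplicities n" "c \<in> multiplicities m" "c 0 = 0" "sum a {..<n} = sum c {..<m}"
      using p pac by (auto simp: balanced_pairs_def)
    have "sum c {..<m} \<le> (\<Sum>i<m. i * c i)"
    proof (rule sum_mono)
      fix i show "c i \<le> i * c i" using ac(3) by (cases i) auto
    qed
    then have w: "sum c {..<m} \<le> w" "sum a {..<n} \<le> w" using p pac ac(4) by auto
    have "a k \<le> w" if "k < n" for k
      using w(2) member_le_sum[of k "{..<n}" a] that by simp
    moreover have "c k \<le> w" if "k < m" for k
      using w(1) member_le_sum[of k "{..<m}" c] that by simp
    ultimately show "p \<in> ?F n \<times> ?F m" using ac(1,2) pac by (auto simp: multiplicities_def)
  qed
qed

lemma prod_z_var: "\<exists>u. (\<Prod>i\<in>I. z_var i ^ k i) = fps_const u"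
proof (cases "finite I")
  case True
  then show ?thesis
  proof (induction I)
    case (insert i I)
    then obtain u where "(\<Prod>i\<in>I. z_var i ^ k i) = fps_const u" by blast
    then show ?case using insert by (auto simp: z_var_def)
  qed (auto intro: exI[of _ 1])
qed (auto intro: exI[of _ 1])

lemma pair_term_summable: "pair_term m n summable_on balanced_pairs m n"
proof (rule summable_on_fps)
  fix k
  have "fps_nth (pair_term m n p) k = 0"
    if "m * (\<Sum>k<n. k * fst p k) + (\<Sum>i<m. i * snd p i) \<noteq> k" for p
  proof -
    obtain u where "(\<Prod>i = 1..m - 1. z_var i ^ snd p i) = fps_const u" using prod_z_var by blast
    then show ?thesis using that by (simp add: pair_term_def q_var_def fps_X_power_nth)
  qed
  then show "finite {p \<in> balanced_pairs m n. fps_nth (pair_term m n p) k \<noteq> 0}"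
    by (intro finite_subset[OF _ finite_balanced_pairs[of m n k]]) auto
qed

theorem theorem1p3:
  fixes m n :: nat
  assumes "m \<ge> 2" and "n \<ge> 1"
  shows "L_term m summable_on L_desc m n
    \<and> O_term m summable_on O_desc m n
    \<and> (\<Sum>\<^sub>\<infinity>\<mu>\<in>L_desc m n. L_term m \<mu>) = (\<Sum>\<^sub>\<infinity>\<nu>\<in>O_desc m n. O_term m \<nu>)"
proof -
  obtain g where g: "bij_betw g (lecture_hall n) (multiplicities n)"
    and odd: "\<And>e. e \<in> lecture_hall n \<Longrightarrow> odd_sum n e = (\<Sum>k<n. k * g e k)"
    and even: "\<And>e. e \<in> lecture_hall n \<Longrightarrow> even_sum n e = (\<Sum>k<n. g e k) + (\<Sum>k<n. k * g e k)"
    using lecture_hall_bijection[of n] by blast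
  \<comment> \<open>Since \<open>even_sum n e\<close> exceeds \<open>odd_sum n e\<close> by the sum
    of \<open>g e\<close>, the condition on sums in \<open>profiles\<close> becomes the one in
    \<open>balanced_pairs\<close>, with \<open>c\<close> unchanged.\<close>
  have "bij_betw (map_prod g id) (profiles m n) (balanced_pairs m n)"
  proof (rule bij_betw_imageI)
    show "inj_on (map_prod g id) (profiles m n)"
      using bij_betw_imp_inj_on[OF g] by (auto simp: inj_on_def profiles_def)
    show "map_prod g id ` profiles m n = balanced_pairs m n"
    proof
      show "map_prod g id ` profiles m n \<subseteq> balanced_pairs m n"
        using bij_betwE[OF g] odd even by (auto simp: profiles_def balanced_pairs_def)
      show "balanced_pairs m n \<subseteq> map_prod g id ` profiles m n"
      proof
        fix p assume "p \<in> balanced_pairs m n"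
        then obtain a c where p: "p = (a, c)" "a \<in> multiplicities n" "(a, c) \<in> balanced_pairs m n"
          by (auto simp: balanced_pairs_def)
        have "a \<in> g ` lecture_hall n" using p(2) bij_betw_imp_surj_on[OF g] by simp
        then obtain e where e: "e \<in> lecture_hall n" "g e = a" by blast
        then have "(e, c) \<in> profiles m n"
          using p(3) odd[of e] even[of e] by (simp add: profiles_def balanced_pairs_def)
        then show "p \<in> map_prod g id ` profiles m n" using e p(1) by force
      qed
    qed
  qed
  then have L: "bij_betw (map_prod g id \<circ> profile m) (L_desc m n) (balanced_pairs m n)"
    using bij_betw_L_desc[OF assms(1)] bij_betw_trans by blast
  have O: "bij_betw (quotient_residue_counts m) (O_desc m n) (balanced_pairs m n)"
    by (rule bij_betw_O_desc[OF assms])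
  have L_eq: "pair_term m n ((map_prod g id \<circ> profile m) f) = L_term m f" if f: "f \<in> L_desc m n" for f
  proof -
    obtain e c where q: "profile m f = (e, c)" by force
    have "e \<in> lecture_hall n" using profile_mem[OF assms(1) f] q by (auto simp: profiles_def)
    then have "weight f = m * (\<Sum>k<n. k * g e k) + (\<Sum>i<m. i * c i)"
      using weight_L_desc[OF assms(1) f q] odd by simp
    moreover have "(\<Prod>i = 1..m - 1. z_var i ^ c i) = (\<Prod>i = 1..m - 1. z_var i ^ alt_sum m i f)"
      by (rule prod.cong) (use q assms in \<open>auto simp: profile_def\<close>)
    ultimately show ?thesis by (simp add: pair_term_def L_term_def q)
  qed
  have O_eq: "pair_term m n (quotient_residue_counts m f) = O_term m f" if f: "f \<in> O_desc m n" for f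
  proof -
    obtain a c where q: "quotient_residue_counts m f = (a, c)" by force
    have "(\<Prod>i = 1..m - 1. z_var i ^ c i) = (\<Prod>i = 1..m - 1. z_var i ^ residue_count m i f)"
      by (rule prod.cong) (use q assms in \<open>auto simp: quotient_residue_counts_def residue_count_def\<close>)
    then show ?thesis using weight_O_desc[OF assms f q] by (simp add: pair_term_def O_term_def q)
  qed
  have "L_term m summable_on L_desc m n \<longleftrightarrow> (\<lambda>f. pair_term m n ((map_prod g id \<circ> profile m) f)) summable_on L_desc m n"
    by (rule summable_on_cong) (rule L_eq[symmetric])
  also have "\<dots> \<longleftrightarrow> pair_term m n summable_on balanced_pairs m n"
    by (rule summable_on_reindex_bij_betw[OF L])
  finally have L_summable: "L_term m summable_on L_desc m n" using pair_term_summable by simp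
  have "O_term m summable_on O_desc m n \<longleftrightarrow> (\<lambda>f. pair_term m n (quotient_residue_counts m f)) summable_on O_desc m n"
    by (rule summable_on_cong) (rule O_eq[symmetric])
  also have "\<dots> \<longleftrightarrow> pair_term m n summable_on balanced_pairs m n"
    by (rule summable_on_reindex_bij_betw[OF O])
  finally have O_summable: "O_term m summable_on O_desc m n" using pair_term_summable by simp
  have "(\<Sum>\<^sub>\<infinity>\<mu>\<in>L_desc m n. L_term m \<mu>) = (\<Sum>\<^sub>\<infinity>\<mu>\<in>L_desc m n. pair_term m n ((map_prod g id \<circ> profile m) \<mu>))"
    by (rule infsum_cong) (rule L_eq[symmetric])
  also have "\<dots> = infsum (pair_term m n) (balanced_pairs m n)"
    by (rule infsum_reindex_bij_betw[OF L])
  also have "\<dots> = (\<Sum>\<^sub>\<infinity>\<nu>\<in>O_desc m n. pair_term m n (quotient_residue_counts m \<nu>))"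
    by (rule infsum_reindex_bij_betw[OF O, symmetric])
  also have "\<dots> = (\<Sum>\<^sub>\<infinity>\<nu>\<in>O_desc m n. O_term m \<nu>)"
    by (rule infsum_cong) (rule O_eq)
  finally show ?thesis using L_summable O_summable by blast
qed

end
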